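(* Let $X$ be a geodesic metric space and let $\gamma\colon\mathbb{R}\to X$ be a quasi-geodesic in $X$. The following are equivalent: (1) $\gamma$ (i.e. its image) is sublinearly contracting. (2) $\gamma$ (i.e. its image) is Morse. (3) $\gamma$ has completely superlinear divergence.
   Context: Functions are real valued with domain $[0,\infty)$ unless otherwise noted. For $L\ge 1$, $A\ge 0$, an $(L,A)$-quasi-geodesic is a (not necessarily continuous) map $\gamma$ from an interval to $X$ with $\frac1L|s-t|-A\le d(\gamma(s),\gamma(t))\le L|s-t|+A$ for all $s,t$. A quasi-geodesic is an $(L,A)$-quasi-geodesic for some $L,A$; it is identified with its image when regarded as a subspace. Contraction. For $Y\subset X$ and $\epsilon\ge 0$, the $\epsilon$-closest point projection is $\pi_Y^\epsilon\colon X\to 2^Y$, $\pi^\epsilon_Y(x)=\{y\in Y\mid d(x,y)\le d(x,Y)+\epsilon\}$. It is $(\rho_1,\rho_2)$-contracting if: the empty set is not in the image of $\pi_Y^\epsilon$; $\rho_1,\rho_2$ are non-decreasing and eventually non-negative; $\rho_1$ is unbounded and $\rho_1(r)\le r$; for all $x,x'\in X$, if $d(x,x')\le\rho_1(d(x,Y))$ then $\operatorname{diam}(\pi_Y^\epsilon(x)\cup\pi_Y^\epsilon(x'))\le\rho_2(d(x,Y))$; and $\lim_{r\to\infty}\rho_2(r)/\rho_1(r)=0$. The subspace $Y$ is $(\rho_1,\rho_2)$-contracting if $\pi_Y^\epsilon$ is, for some $\epsilon\ge 0$. $Y$ is sublinearly contracting if it is $(r,\rho_2)$-contracting (that is, $\rho_1(r)=r$)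 for some $\rho_2$. Morse. $Y$ is $\mu$-Morse, for $\mu\colon[1,\infty)\times[0,\infty)\to[0,\infty)$, if for all $L\ge1$, $A\ge0$, every $(L,A)$-quasi-geodesic with endpoints on $Y$ remains within distance $\mu(L,A)$ of $Y$. $Y$ is Morse if it is $\mu$-Morse for some $\mu$. Divergence. Let $\gamma\colon\mathbb{R}\to X$ be an $(L,A)$-quasi-geodesic, $\lambda\in(0,1]$, $\kappa\ge L+A$. Let $\Lambda_\gamma(r,s;L,A,\lambda,\kappa)$ be the infimal length of a path from $\gamma(s-r)$ to $\gamma(s+r)$ disjoint from the ball of radius $\lambda(L^{-1}r-A)-\kappa$ centered at $\gamma(s)$, or $\infty$ if no such path exists. The $(L,A,\lambda,\kappa)$-divergence of $\gamma$ is $\Delta_\gamma(r;L,A,\lambda,\kappa)=\inf_s\Lambda_\gamma(r,s;L,A,\lambda,\kappa)$. A function $g$ (possibly with value $\infty$) is completely superlinear if for all $C_1>0,C_2>0,C_3\ge0,C_4\ge0$ the set of $r\in[0,\infty)$ with $g(r)\le C_1(C_2r+C_3)+C_4$ is bounded. $\gamma$ has completely superlinear divergence if $\Delta_\gamma(\cdot;L,A,\lambda,\kappa)$ is completely superlinear (this does not depend on the admissible choice of $L,A,\lambda,\kappa$). *)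

theory Defs
  imports "HOL-Analysis.Analysis"
begin

class geodesic_metric_space = metric_space +
  assumes ex_geodesic:
    "\<exists>g :: real \<Rightarrow> 'a. g 0 = x \<and> g (dist x y) = y \<and>
       (\<forall>s\<in>{0..dist x y}. \<forall>t\<in>{0..dist x y}. dist (g s) (g t) = \<bar>s - t\<bar>)"

definition quasi_geodesic_on :: "real \<Rightarrow> real \<Rightarrow> real set \<Rightarrow> (real \<Rightarrow> 'a::metric_space) \<Rightarrow> bool" where
  "quasi_geodesic_on L A I \<gamma> \<longleftrightarrow>
     L \<ge> 1 \<and> A \<ge> 0 \<and> is_interval I \<and>
     (\<forall>s\<in>I. \<forall>t\<in>I. \<bar>s - t\<bar> / L - A \<le> dist (\<gamma> s) (\<gamma> t) \<and>
                     dist (\<gamma> s) (\<gamma> t) \<le> L * \<bar>s - t\<bar> + A)"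

definition near_proj :: "real \<Rightarrow> 'a::metric_space set \<Rightarrow> 'a \<Rightarrow> 'a set" where
  "near_proj \<epsilon> Y x = {y \<in> Y. dist x y \<le> infdist x Y + \<epsilon>}"

text \<open>
  Real functions with domain \<open>[0,\<infinity>)\<close> are represented by functions on all reals of which
  only the values on \<open>{0..}\<close> matter.
  Each set \<open>near_proj \<epsilon> Y x\<close> is bounded, so the library's \<open>diameter\<close> is the true diameter here.
\<close>

definition contracting_proj ::
  "(real \<Rightarrow> real) \<Rightarrow> (real \<Rightarrow> real) \<Rightarrow> real \<Rightarrow> 'a::metric_space set \<Rightarrow> bool" where
  "contracting_proj \<rho>1 \<rho>2 \<epsilon> Y \<longleftrightarrow>
     {} \<notin> range (near_proj \<epsilon> Y) \<and>
     mono_on {0..} \<rho>1 \<and> mono_on {0..} \<rho>2 \<and>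
     (\<forall>\<^sub>F r in at_top. \<rho>1 r \<ge> 0) \<and> (\<forall>\<^sub>F r in at_top. \<rho>2 r \<ge> 0) \<and>
     \<not> bounded (\<rho>1 ` {0..}) \<and> (\<forall>r\<ge>0. \<rho>1 r \<le> r) \<and>
     (\<forall>x x'. dist x x' \<le> \<rho>1 (infdist x Y) \<longrightarrow>
        diameter (near_proj \<epsilon> Y x \<union> near_proj \<epsilon> Y x') \<le> \<rho>2 (infdist x Y)) \<and>
     ((\<lambda>r. \<rho>2 r / \<rho>1 r) \<longlongrightarrow> 0) at_top"

definition contracting :: "(real \<Rightarrow> real) \<Rightarrow> (real \<Rightarrow> real) \<Rightarrow> 'a::metric_space set \<Rightarrow> bool" where
  "contracting \<rho>1 \<rho>2 Y \<longleftrightarrow> (\<exists>\<epsilon>\<ge>0. contracting_proj \<rho>1 \<rho>2 \<epsilon> Y)"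

definition sublinearly_contracting :: "'a::metric_space set \<Rightarrow> bool" where
  "sublinearly_contracting Y \<longleftrightarrow> (\<exists>\<rho>2. contracting (\<lambda>r. r) \<rho>2 Y)"

text \<open>
  A quasi-geodesic with endpoints has a compact interval as its domain.
\<close>

definition mu_Morse :: "(real \<Rightarrow> real \<Rightarrow> real) \<Rightarrow> 'a::metric_space set \<Rightarrow> bool" where
  "mu_Morse \<mu> Y \<longleftrightarrow>
     (\<forall>L\<ge>1. \<forall>A\<ge>0. \<forall>a b \<beta>. a \<le> b \<longrightarrow> quasi_geodesic_on L A {a..b} \<beta> \<longrightarrow>
        \<beta> a \<in> Y \<longrightarrow> \<beta> b \<in> Y \<longrightarrow> (\<forall>t\<in>{a..b}. infdist (\<beta> t) Y \<le> \<mu> L A))"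

definition Morse :: "'a::metric_space set \<Rightarrow> bool" where
  "Morse Y \<longleftrightarrow> (\<exists>\<mu>. (\<forall>L\<ge>1. \<forall>A\<ge>0. \<mu> L A \<ge> 0) \<and> mu_Morse \<mu> Y)"

definition path_length :: "(real \<Rightarrow> 'a::metric_space) \<Rightarrow> ereal" where
  "path_length p =
     (SUP ts \<in> {ts. sorted ts \<and> set ts \<subseteq> {0..1}}.
        ereal (\<Sum>i<length ts - 1. dist (p (ts ! i)) (p (ts ! Suc i))))"

text \<open>
  The ball to be avoided is the open one, which is empty if its radius is not positive.
  The infimum of the empty set in \<^typ>\<open>ereal\<close> is \<open>\<infinity>\<close>.
\<close>

definition avoiding_length ::
  "(real \<Rightarrow> 'a::metric_space) \<Rightarrow> real \<Rightarrow> real \<Rightarrow> real \<Rightarrow> real \<Rightarrow> real \<Rightarrow> real \<Rightarrow> ereal" where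
  "avoiding_length \<gamma> L A l \<kappa> r s =
     (INF p \<in> {p. path p \<and> pathstart p = \<gamma> (s - r) \<and> pathfinish p = \<gamma> (s + r) \<and>
                   path_image p \<inter> ball (\<gamma> s) (l * (r / L - A) - \<kappa>) = {}}. path_length p)"

definition divergence ::
  "(real \<Rightarrow> 'a::metric_space) \<Rightarrow> real \<Rightarrow> real \<Rightarrow> real \<Rightarrow> real \<Rightarrow> real \<Rightarrow> ereal" where
  "divergence \<gamma> L A l \<kappa> r = (INF s. avoiding_length \<gamma> L A l \<kappa> r s)"

definition completely_superlinear :: "(real \<Rightarrow> ereal) \<Rightarrow> bool" where
  "completely_superlinear g \<longleftrightarrow>
     (\<forall>C1>0. \<forall>C2>0. \<forall>C3\<ge>0. \<forall>C4\<ge>0.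
        bounded {r. r \<ge> 0 \<and> g r \<le> ereal (C1 * (C2 * r + C3) + C4)})"

end

theory Submission
  imports Defs
begin

text \<open>
  If \<open>Y\<close> is sublinearly contracting, then the projection to \<open>Y\<close> of a rectifiable chain that stays far
  from \<open>Y\<close> is shorter than the chain by an arbitrarily large factor, because the chain can be cut into
  pieces contained in balls disjoint from \<open>Y\<close>. A quasi-geodesic cannot be much longer than the
  distance of its endpoints, so its excursions from \<open>Y\<close> are bounded. A path around a point of \<open>\<gamma>\<close> at
  distance proportional to \<open>r\<close> has an excursion whose projection has diameter at least proportional
  to \<open>r\<close>, so its length is superlinear.

  If \<open>Y\<close> is not sublinearly contracting, then there are balls of radii \<open>r \<rightarrow> \<infinity>\<close> disjoint
  from \<open>Y\<close> that contain two points whose projections are at distance at least \<open>c r\<close>. The two points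
  and their projections span a path with endpoints on \<open>Y\<close> of length at most \<open>4 r + 2\<close>. Cutting its
  corners turns it into a quasi-geodesic that violates the Morse property. When \<open>Y\<close> is the image
  of \<open>\<gamma>\<close>, the path stays at distance proportional to \<open>r\<close> from the point of \<open>\<gamma>\<close> midway between its endpoints,
  so the divergence is at most linear on an unbounded set.
\<close>

subsection \<open>Nearly closest point projections\<close>

lemma near_projD:
  assumes "y \<in> near_proj \<epsilon> Y x"
  shows "y \<in> Y" "dist x y \<le> infdist x Y + \<epsilon>"
  using assms by (auto simp: near_proj_def)

lemma near_proj_nonempty:
  assumes "Y \<noteq> {}" "\<epsilon> > 0"
  shows "near_proj \<epsilon> Y x \<noteq> {}"
proof -
  have "\<exists>y\<in>Y. dist x y < infdist x Y + \<epsilon>"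
    using assms cINF_less_iff[of Y "dist x" "infdist x Y + \<epsilon>"]
    by (auto simp: infdist_def)
  then show ?thesis by (force simp: near_proj_def)
qed

text \<open>The crude bound through \<open>x\<close> and \<open>x'\<close>. It serves near
  \<open>Y\<close>, where contraction says nothing.\<close>

lemma dist_near_proj_le:
  assumes "p \<in> near_proj \<epsilon> Y x" "q \<in> near_proj \<epsilon> Y x'"
  shows "dist p q \<le> 2 * infdist x Y + 2 * dist x x' + 2 * \<epsilon>"
proof -
  have "dist p q \<le> dist x p + dist x x' + dist x' q"
    by (smt (verit) dist_commute dist_triangle)
  then show ?thesis
    using near_projD(2)[OF assms(1)] near_projD(2)[OF assms(2)] infdist_triangle[of x' Y x]
    by (simp add: dist_commute)
qed

lemma bounded_near_proj: "bounded (near_proj \<epsilon> Y x)"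
  unfolding bounded_def by (auto simp: near_proj_def)

text \<open>The diameter of the empty set is 0 by convention, hence the first premise.\<close>

lemma diameter_leI:
  fixes S :: "'a::metric_space set"
  assumes "S \<noteq> {} \<or> 0 \<le> d" "\<And>x y. x \<in> S \<Longrightarrow> y \<in> S \<Longrightarrow> dist x y \<le> d"
  shows "diameter S \<le> d"
  using assms by (auto simp: diameter_def intro!: cSUP_least)

text \<open>Two points of the same set are compared through a point of the other, whence the factor
  2. It thus suffices to estimate distances with one point in each projection.\<close>

lemma diameter_Un_le:
  fixes S T :: "'a::metric_space set"
  assumes ne: "S \<noteq> {}" "T \<noteq> {}" and d: "\<And>x y. x \<in> S \<Longrightarrow> y \<in> T \<Longrightarrow> dist x y \<le> d"
  shows "diameter (S \<union> T) \<le> 2 * d"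
proof (rule diameter_leI)
  obtain s t where st: "s \<in> S" "t \<in> T" using ne by blast
  have d0: "0 \<le> d" using d[OF st] by (meson dual_order.trans zero_le_dist)
  fix x y assume "x \<in> S \<union> T" "y \<in> S \<union> T"
  then show "dist x y \<le> 2 * d"
  proof (elim UnE)
    assume "x \<in> S" "y \<in> S"
    then show ?thesis
      using dist_triangle2[of x y t] d[of x t] d[of y t] st by simp
  next
    assume "x \<in> S" "y \<in> T"
    then show ?thesis using d[of x y] d0 by simp
  next
    assume "x \<in> T" "y \<in> S"
    then show ?thesis using d[of y x] d0 by (simp add: dist_commute)
  next
    assume "x \<in> T" "y \<in> T"
    then show ?thesis
      using dist_triangle3[of x y s] d[of s x] d[of s y] st by simp
  qed
qed (use ne in blast)

subsection \<open>Sublinear contraction\<close>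

text \<open>The best possible gauge is the supremum of the diameters of the projections of the balls
  that have to be considered; a pair of points at small height contributes only a constant.\<close>

lemma sublinearly_contractingI:
  fixes Y :: "'a::metric_space set"
  assumes ne: "Y \<noteq> {}"
    and small: "\<And>c. 0 < c \<Longrightarrow> \<exists>N. \<forall>x x' p q. N \<le> infdist x Y \<longrightarrow> dist x x' \<le> infdist x Y \<longrightarrow>
      p \<in> near_proj 1 Y x \<longrightarrow> q \<in> near_proj 1 Y x' \<longrightarrow> dist p q \<le> c * infdist x Y"
  shows "sublinearly_contracting Y"
proof -
  let ?\<pi> = "near_proj 1 Y"
  define S where "S r = {diameter (?\<pi> x \<union> ?\<pi> x') | x x'. dist x x' \<le> infdist x Y \<and> infdist x Y \<le> r}"
    for r :: real
  define \<rho> where "\<rho> r = Sup (S r)" for r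
  have pne: "?\<pi> x \<noteq> {}" for x using near_proj_nonempty[OF ne] by simp
  obtain y where y: "y \<in> Y" using ne by blast
  have Sne: "S r \<noteq> {}" if "0 \<le> r" for r
  proof -
    have "diameter (?\<pi> y \<union> ?\<pi> y) \<in> S r"
      unfolding S_def using y that by (intro CollectI exI[of _ y]) auto
    then show ?thesis by blast
  qed
  have bd: "bdd_above (S r)" for r
  proof (rule bdd_aboveI)
    fix d assume "d \<in> S r"
    then obtain x x' where d: "d = diameter (?\<pi> x \<union> ?\<pi> x')" "dist x x' \<le> infdist x Y" "infdist x Y \<le> r"
      by (auto simp: S_def)
    have "diameter (?\<pi> x \<union> ?\<pi> x') \<le> 2 * (4 * r + 2)"
      by (rule diameter_Un_le[OF pne pne])
        (use d(2,3) dist_near_proj_le in fastforce)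
    then show "d \<le> 2 * (4 * r + 2)" using d by simp
  qed
  have nonneg: "0 \<le> \<rho> r" if r: "0 \<le> r" for r
  proof -
    obtain d where d: "d \<in> S r" using Sne[OF r] by blast
    have "0 \<le> d" using d bounded_near_proj by (auto simp: S_def intro!: diameter_ge_0)
    then show ?thesis unfolding \<rho>_def using cSup_upper[OF d bd] by simp
  qed
  have lim: "((\<lambda>r. \<rho> r / r) \<longlongrightarrow> 0) at_top"
  proof (rule tendstoI)
    fix e :: real assume e: "0 < e"
    \<comment> \<open>\<open>diameter_Un_le\<close> doubles \<open>c\<close>, and
      \<open>e / 2\<close> is strictly below \<open>e\<close>.\<close>
    define c where "c = e / 4"
    have c: "0 < c" using e by (simp add: c_def)
    from small[OF c] obtain N where N: "\<And>x x' p q. \<lbrakk>N \<le> infdist x Y; dist x x' \<le> infdist x Y;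
      p \<in> ?\<pi> x; q \<in> ?\<pi> x'\<rbrakk> \<Longrightarrow> dist p q \<le> c * infdist x Y" by blast
    \<comment> \<open>From \<open>(4 * N + 2) / c\<close> on, pairs of height below \<open>N\<close>
      are harmless: the crude bound gives them at most \<open>4 * N + 2\<close>.\<close>
    have "\<rho> r \<le> 2 * (c * r)" if r: "r \<ge> 1" "r \<ge> (4 * N + 2) / c" for r
      unfolding \<rho>_def
    proof (rule cSup_least)
      show "S r \<noteq> {}" using Sne r by simp
      fix d assume "d \<in> S r"
      then obtain x x' where d: "d = diameter (?\<pi> x \<union> ?\<pi> x')" "dist x x' \<le> infdist x Y"
          "infdist x Y \<le> r"
        by (auto simp: S_def)
      have cr: "4 * N + 2 \<le> c * r" using r c by (simp add: field_simps)
      have "dist p q \<le> c * r" if "p \<in> ?\<pi> x" "q \<in> ?\<pi> x'" for p q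
      proof (cases "N \<le> infdist x Y")
        case True
        have "dist p q \<le> c * infdist x Y" by (rule N[OF True d(2) that])
        also have "\<dots> \<le> c * r" using d(3) c by simp
        finally show ?thesis .
      next
        case False
        then show ?thesis using dist_near_proj_le[OF that] d cr by simp
      qed
      then show "d \<le> 2 * (c * r)" unfolding d(1) by (rule diameter_Un_le[OF pne pne])
    qed
    then have "\<forall>r\<ge>max 1 ((4 * N + 2) / c). dist (\<rho> r / r) 0 < e"
      using nonneg e by (auto simp: c_def dist_real_def field_simps) (smt (verit) mult_pos_pos)
    then show "\<forall>\<^sub>F r in at_top. dist (\<rho> r / r) 0 < e"
      unfolding eventually_at_top_linorder by blast
  qed
  have pne': "{} \<notin> range ?\<pi>" using pne by (metis imageE)
  have "mono_on {0..} \<rho>"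
  proof (rule mono_onI)
    fix r s :: real assume rs: "r \<in> {0..}" "s \<in> {0..}" "r \<le> s"
    have "S r \<subseteq> S s" unfolding S_def using rs by fastforce
    then show "\<rho> r \<le> \<rho> s" unfolding \<rho>_def using Sne rs bd by (intro cSup_subset_mono) auto
  qed
  moreover have "\<not> bounded ((\<lambda>r::real. r) ` {0..})"
    by (auto simp: bounded_iff not_le intro: bexI[of _ "\<bar>_\<bar> + 1"]) (meson abs_ge_zero atLeast_iff dual_order.strict_trans2 gt_ex less_imp_le linorder_linear)
  moreover have "diameter (?\<pi> x \<union> ?\<pi> x') \<le> \<rho> (infdist x Y)" if "dist x x' \<le> infdist x Y" for x x'
    unfolding \<rho>_def using that by (intro cSup_upper bd) (auto simp: S_def)
  moreover have "\<forall>\<^sub>F r in at_top. \<rho> r \<ge> 0"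
    using nonneg eventually_at_top_linorder by blast
  ultimately have "contracting_proj (\<lambda>r. r) \<rho> 1 Y"
    unfolding contracting_proj_def using pne' lim
    by (auto simp: mono_on_def )
  then show ?thesis
    unfolding sublinearly_contracting_def contracting_def by (meson zero_le_one)
qed

text \<open>The limit is unpacked into linear bounds of arbitrarily small slope \<open>k\<close>
  from some height \<open>R\<close> on. Choosing \<open>R0\<close> large keeps the steps of a chain
  small against \<open>R\<close>.\<close>

lemma sublinearly_contractingD:
  fixes Y :: "'a::metric_space set"
  assumes "sublinearly_contracting Y"
  obtains \<epsilon> where "0 \<le> \<epsilon>" "\<And>x. near_proj \<epsilon> Y x \<noteq> {}"
    "\<And>k R0. 0 < k \<Longrightarrow> \<exists>R\<ge>R0. \<forall>x x' p q. R \<le> infdist x Y \<longrightarrow> dist x x' \<le> infdist x Y \<longrightarrow>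
      p \<in> near_proj \<epsilon> Y x \<longrightarrow> q \<in> near_proj \<epsilon> Y x' \<longrightarrow> dist p q \<le> k * infdist x Y"
proof -
  obtain \<rho> \<epsilon> where e: "0 \<le> \<epsilon>" and c: "contracting_proj (\<lambda>r. r) \<rho> \<epsilon> Y"
    using assms unfolding sublinearly_contracting_def contracting_def by blast
  have "\<exists>R\<ge>R0. \<forall>x x' p q. R \<le> infdist x Y \<longrightarrow> dist x x' \<le> infdist x Y \<longrightarrow>
      p \<in> near_proj \<epsilon> Y x \<longrightarrow> q \<in> near_proj \<epsilon> Y x' \<longrightarrow> dist p q \<le> k * infdist x Y"
    if k: "0 < k" for k R0
  proof -
    have "\<forall>\<^sub>F r in at_top. dist (\<rho> r / r) 0 < k"
      using c k unfolding contracting_proj_def by (blast dest: tendstoD)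
    then obtain R where R: "\<And>r. r \<ge> R \<Longrightarrow> dist (\<rho> r / r) 0 < k"
      unfolding eventually_at_top_linorder by blast
    let ?R = "max R0 (max R 1)"
    have "dist p q \<le> k * infdist x Y"
      if h: "?R \<le> infdist x Y" and d: "dist x x' \<le> infdist x Y"
        and p: "p \<in> near_proj \<epsilon> Y x" and q: "q \<in> near_proj \<epsilon> Y x'" for x x' p q
    proof -
      have "dist p q \<le> diameter (near_proj \<epsilon> Y x \<union> near_proj \<epsilon> Y x')"
        using p q bounded_near_proj by (intro diameter_bounded_bound) auto
      also have "\<dots> \<le> \<rho> (infdist x Y)" using c d unfolding contracting_proj_def by blast
      also have "\<dots> \<le> k * infdist x Y"
        using R[of "infdist x Y"] h by (simp add: dist_real_def field_simps abs_if split: if_splits)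
      finally show ?thesis .
    qed
    then show ?thesis by (intro exI[of _ ?R]) auto
  qed
  moreover have "near_proj \<epsilon> Y x \<noteq> {}" for x
    using c unfolding contracting_proj_def by (metis rangeI)
  ultimately show ?thesis using that e by blast
qed

subsection \<open>Chains far from the set\<close>

lemma dist_le_sum_steps:
  fixes x :: "nat \<Rightarrow> 'a::metric_space"
  assumes "i \<le> n"
  shows "dist (x i) (x n) \<le> (\<Sum>j=i..<n. dist (x j) (x (Suc j)))"
  using assms
proof (induction rule: dec_induct)
  case (step n)
  then show ?case using dist_triangle[of "x i" "x (Suc n)" "x n"] by simp
qed simp

text \<open>The chain is cut at the last point before it first leaves the ball around
  \<open>x i\<close> of radius \<open>h / 2\<close>, where \<open>h\<close> is the height of
  \<open>x i\<close>. Steps are at most \<open>h / 4\<close>, so this piece has length at least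
  \<open>h / 4\<close>, while its projection moves by at most \<open>k * h\<close>. Induction
  handles the rest; a final piece that never leaves the half ball ends at height at least
  \<open>h / 2\<close> and accounts for the last summand.\<close>

lemma dist_near_proj_chain_high:
  fixes Y :: "'a::metric_space set" and x :: "nat \<Rightarrow> 'a"
  assumes K: "4 * K \<le> R" "0 < R" and k: "0 \<le> k"
    and ne: "\<And>x. near_proj \<epsilon> Y x \<noteq> {}"
    and C: "\<And>x x' p q. \<lbrakk>R \<le> infdist x Y; dist x x' \<le> infdist x Y; p \<in> near_proj \<epsilon> Y x;
       q \<in> near_proj \<epsilon> Y x'\<rbrakk> \<Longrightarrow> dist p q \<le> k * infdist x Y"
  shows "\<lbrakk>i \<le> n; \<And>j. j \<in> {i..n} \<Longrightarrow> R \<le> infdist (x j) Y;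
      \<And>j. j \<in> {i..<n} \<Longrightarrow> dist (x j) (x (Suc j)) \<le> K;
      p \<in> near_proj \<epsilon> Y (x i); q \<in> near_proj \<epsilon> Y (x n)\<rbrakk> \<Longrightarrow>
    dist p q \<le> 4 * k * (\<Sum>j=i..<n. dist (x j) (x (Suc j))) + 2 * k * infdist (x n) Y"
proof (induction "n - i" arbitrary: i p rule: less_induct)
  case less
  let ?h = "infdist (x i) Y"
  let ?len = "\<lambda>i n. \<Sum>j=i..<n. dist (x j) (x (Suc j))"
  have h: "R \<le> ?h" using less.prems by simp
  have len0: "0 \<le> ?len a b" for a b by (simp add: sum_nonneg)
  show ?case
  proof (cases "\<exists>j\<in>{i..n}. dist (x i) (x j) > ?h / 2")
    case False
    then have d: "dist (x i) (x n) \<le> ?h / 2" using less.prems(1) by (auto simp: not_less)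
    have "dist p q \<le> k * ?h"
      by (rule C[OF h _ less.prems(4,5)]) (use d h K in linarith)
    moreover have "?h \<le> 2 * infdist (x n) Y"
      using d infdist_triangle[of "x i" Y "x n"] by simp
    then have "k * ?h \<le> k * (2 * infdist (x n) Y)" using k by (rule mult_left_mono)
    moreover have "0 \<le> 4 * k * ?len i n" using k len0 by simp
    ultimately show ?thesis by simp
  next
    case True
    define P where "P j \<longleftrightarrow> i \<le> j \<and> j \<le> n \<and> dist (x i) (x j) > ?h / 2" for j
    define j where "j = (LEAST j. P j)"
    have "\<exists>j. P j" using True by (auto simp: P_def)
    then have "P j" unfolding j_def by (rule LeastI_ex)
    then have j: "i \<le> j" "j \<le> n" "dist (x i) (x j) > ?h / 2"
      by (auto simp: P_def)
    have before: "dist (x i) (x m) \<le> ?h / 2" if "i \<le> m" "m < j" for m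
      using not_less_Least[of m P] that j(2) unfolding j_def[symmetric] by (auto simp: P_def)
    have "j \<noteq> i" using j(3) h K by auto
    then obtain m where m: "j = Suc m" "i \<le> m" using j(1) by (cases j) (auto simp: le_Suc_eq)
    have Km: "dist (x m) (x (Suc m)) \<le> K" using less.prems(3)[of m] m j by simp
    have lower: "?h / 4 \<le> dist (x i) (x m)"
      using j(3) Km h K m dist_triangle[of "x i" "x j" "x m"] by simp
    then have "m \<noteq> i" using h K by auto
    then have mi: "i < m" using m by simp
    obtain p' where p': "p' \<in> near_proj \<epsilon> Y (x m)" using ne by blast
    have "dist p p' \<le> k * ?h"
      by (rule C[OF h _ less.prems(4) p']) (use before[of m] mi m h K in auto)
    also have "\<dots> \<le> k * (4 * ?len i m)"
      using lower dist_le_sum_steps[of i m x] mi k by (intro mult_left_mono) auto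
    finally have 1: "dist p p' \<le> 4 * k * ?len i m" by simp
    have 2: "dist p' q \<le> 4 * k * ?len m n + 2 * k * infdist (x n) Y"
      by (rule less.hyps) (use mi m j less.prems p' in auto)
    have "?len i m + ?len m n = ?len i n"
      using mi m j by (intro sum.atLeastLessThan_concat) auto
    then have "4 * k * ?len i n = 4 * k * ?len i m + 4 * k * ?len m n"
      by (metis distrib_left)
    with 1 2 show ?thesis using dist_triangle[of p q p'] by argo
  qed
qed

text \<open>This treats one excursion from \<open>Y\<close>. Only its interior is high enough for
  contraction; the first and the last step are projected by the crude bound.\<close>

lemma dist_near_proj_chain:
  fixes Y :: "'a::metric_space set" and x :: "nat \<Rightarrow> 'a"
  assumes K: "4 * K \<le> R" "0 < R" "0 \<le> K" and k: "0 \<le> k" "k \<le> 1" and "0 \<le> \<epsilon>"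
    and ne: "\<And>x. near_proj \<epsilon> Y x \<noteq> {}"
    and C: "\<And>x x' p q. \<lbrakk>R \<le> infdist x Y; dist x x' \<le> infdist x Y; p \<in> near_proj \<epsilon> Y x;
       q \<in> near_proj \<epsilon> Y x'\<rbrakk> \<Longrightarrow> dist p q \<le> k * infdist x Y"
    and ij: "i < j"
    and low: "infdist (x i) Y \<le> R" "infdist (x j) Y \<le> R"
    and high: "\<And>m. \<lbrakk>i < m; m < j\<rbrakk> \<Longrightarrow> R \<le> infdist (x m) Y"
    and step: "\<And>m. m \<in> {i..<j} \<Longrightarrow> dist (x m) (x (Suc m)) \<le> K"
    and p: "p \<in> near_proj \<epsilon> Y (x i)" and q: "q \<in> near_proj \<epsilon> Y (x j)"
  shows "dist p q \<le> 6 * R + 4 * \<epsilon> + 6 * K + 4 * k * (\<Sum>m=i..<j. dist (x m) (x (Suc m)))"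
proof (cases "j = Suc i")
  case True
  have "dist p q \<le> 2 * infdist (x i) Y + 2 * dist (x i) (x j) + 2 * \<epsilon>"
    by (rule dist_near_proj_le[OF p q])
  moreover have "0 \<le> 4 * k * (\<Sum>m=i..<j. dist (x m) (x (Suc m)))"
    using k by (simp add: sum_nonneg)
  ultimately show ?thesis using step[of i] True low K \<open>0 \<le> \<epsilon>\<close> by simp
next
  case False
  define b where "b = j - 1"
  have b: "j = Suc b" "Suc i \<le> b" using ij False by (auto simp: b_def)
  obtain p' q' where p': "p' \<in> near_proj \<epsilon> Y (x (Suc i))" and q': "q' \<in> near_proj \<epsilon> Y (x b)"
    using ne by (metis all_not_in_conv)
  have Ki: "dist (x i) (x (Suc i)) \<le> K" "dist (x b) (x j) \<le> K" using step b by auto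
  have 1: "dist p p' \<le> 2 * R + 2 * K + 2 * \<epsilon>"
    using dist_near_proj_le[OF p p'] Ki low by simp
  have 2: "dist q' q \<le> 2 * R + 2 * K + 2 * \<epsilon>"
    using dist_near_proj_le[OF q q'] Ki low by (simp add: dist_commute)
  define len where "len i n = (\<Sum>m=i..<n. dist (x m) (x (Suc m)))" for i n
  have "dist p' q' \<le> 4 * k * len (Suc i) b + 2 * k * infdist (x b) Y"
    unfolding len_def by (rule dist_near_proj_chain_high[OF K(1,2) k(1) ne C b(2)])
      (use high step b p' q' in auto)
  then have 3: "dist p' q' \<le> 4 * k * len (Suc i) b + 2 * (k * infdist (x b) Y)" by simp
  have "infdist (x b) Y \<le> R + K" using infdist_triangle[of "x b" Y "x j"] Ki low by simp
  \<comment> \<open>The end term of the high chain becomes a constant, since \<open>x b\<close> is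
    one step away from the low point \<open>x j\<close>.\<close>
  then have 4: "k * infdist (x b) Y \<le> 1 * (R + K)" using k infdist_nonneg K by (intro mult_mono) auto
  have "len (Suc i) b \<le> len i j"
    unfolding len_def using b by (intro sum_mono2) auto
  then have 5: "4 * k * len (Suc i) b \<le> 4 * k * len i j" using k by (intro mult_left_mono) auto
  have "dist p q \<le> dist p p' + dist p' q' + dist q' q"
    by (smt (verit) dist_triangle)
  then show ?thesis using 1 2 3 4 5 unfolding len_def[symmetric] by argo
qed

subsection \<open>Sublinear contraction implies Morse\<close>

text \<open>With \<open>P\<close> meaning "close to \<open>Y\<close>", this isolates the excursion
  of a chain that contains index \<open>m\<close>.\<close>

lemma nat_gap_around:
  fixes P :: "nat \<Rightarrow> bool"
  assumes "P 0" "P n" "m \<le> n" "\<not> P m"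
  obtains i j where "i < m" "m < j" "j \<le> n" "P i" "P j" "\<And>u. \<lbrakk>i < u; u < j\<rbrakk> \<Longrightarrow> \<not> P u"
proof -
  define i where "i = (GREATEST i. P i \<and> i < m)"
  define j where "j = (LEAST j. P j \<and> m < j)"
  have m: "0 < m" "m < n" using assms by (metis gr0I, metis le_neq_implies_less)
  have i: "P i \<and> i < m" unfolding i_def
    by (rule GreatestI_nat[of "\<lambda>i. P i \<and> i < m" 0 m]) (use assms m in auto)
  have j: "P j \<and> m < j" unfolding j_def
    by (rule LeastI[of "\<lambda>j. P j \<and> m < j" n]) (use assms m in auto)
  have jn: "j \<le> n" unfolding j_def
    by (rule Least_le) (use assms m in auto)
  have "\<not> P u" if "i < u" "u < j" for u
  proof
    assume P: "P u"
    then have "u \<noteq> m" using assms by auto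
    then consider "u < m" | "m < u" by linarith
    then show False
    proof cases
      case 1
      then have "u \<le> i" unfolding i_def
        using P by (intro Greatest_le_nat[of "\<lambda>i. P i \<and> i < m" u m]) auto
      with that show False by simp
    next
      case 2
      then have "j \<le> u" unfolding j_def using P by (intro Least_le) auto
      with that show False by simp
    qed
  qed
  then show thesis using that i j jn by blast
qed

text \<open>Here \<open>z\<close> will be the duration of an excursion: a lower bound of slope
  \<open>1 / L\<close> meets an upper bound of half that slope, which is absorbed.\<close>

lemma le_of_divide_le_half:
  fixes z X L :: real
  assumes "1 \<le> L" "(z - 1) / L \<le> X + z / (2 * L)"
  shows "z \<le> 2 + 2 * L * X"
proof -
  have "z - 1 \<le> (X + z / (2 * L)) * L" using assms by (simp add: pos_divide_le_eq)
  moreover have "(X + z / (2 * L)) * L = L * X + z / 2" using assms(1) by (simp add: field_simps)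
  ultimately show ?thesis by simp
qed

text \<open>The quasi-geodesic is sampled at unit times. During an excursion above height
  \<open>R\<close>, the projection moves so little that the endpoints separate at most at rate
  \<open>1 / (2 * L)\<close>, up to a constant, whereas the quasi-geodesic inequality demands rate
  \<open>1 / L\<close>. This bounds the duration and hence the height.\<close>

lemma sublinearly_contracting_imp_bounded_quasi_geodesics:
  fixes Y :: "'a::metric_space set"
  assumes Y: "sublinearly_contracting Y" and L: "1 \<le> L" and A: "0 \<le> A"
  shows "\<exists>M\<ge>0. \<forall>a b \<beta>. a \<le> b \<longrightarrow> quasi_geodesic_on L A {a..b} \<beta> \<longrightarrow>
        \<beta> a \<in> Y \<longrightarrow> \<beta> b \<in> Y \<longrightarrow> (\<forall>t\<in>{a..b}. infdist (\<beta> t) Y \<le> M)"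
proof -
  from Y obtain \<epsilon> where e: "0 \<le> \<epsilon>" and ne: "\<And>x. near_proj \<epsilon> Y x \<noteq> {}"
    and C: "\<And>k R0. 0 < k \<Longrightarrow> \<exists>R\<ge>R0. \<forall>x x' p q. R \<le> infdist x Y \<longrightarrow> dist x x' \<le> infdist x Y \<longrightarrow>
      p \<in> near_proj \<epsilon> Y x \<longrightarrow> q \<in> near_proj \<epsilon> Y x' \<longrightarrow> dist p q \<le> k * infdist x Y"
    by (erule sublinearly_contractingD)
  define K where "K = L + A"
  have K: "1 \<le> K" using L A by (simp add: K_def)
  \<comment> \<open>Chosen so that \<open>4 * k * K\<close> is \<open>1 / (2 * L)\<close>, where
    \<open>K\<close> bounds the displacement per unit of time.\<close>
  define k where "k = 1 / (8 * (L * K))"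
  have LK: "1 \<le> L * K" using L K by (metis mult_mono' mult_1 zero_le_one)
  have k: "0 < k" "k \<le> 1" using LK by (auto simp: k_def)
  from C[OF k(1), of "4 * K"] obtain R where R: "4 * K \<le> R" and
    con: "\<And>x x' p q. \<lbrakk>R \<le> infdist x Y; dist x x' \<le> infdist x Y; p \<in> near_proj \<epsilon> Y x;
       q \<in> near_proj \<epsilon> Y x'\<rbrakk> \<Longrightarrow> dist p q \<le> k * infdist x Y" by blast
  define D where "D = 2 * L * (1 + A + 8 * R + 6 * \<epsilon> + 6 * K)"
  have D: "0 \<le> D" unfolding D_def using L A R K e by (intro mult_nonneg_nonneg) auto
  define M where "M = R + K + K * D"
  have KD: "0 \<le> K * D" using K D by simp
  have "infdist (\<beta> t) Y \<le> M"
    if ab: "a \<le> b" and qg: "quasi_geodesic_on L A {a..b} \<beta>" and end_in: "\<beta> a \<in> Y" "\<beta> b \<in> Y"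
      and t: "t \<in> {a..b}" for a b \<beta> t
  proof -
    define n where "n = nat \<lceil>b - a\<rceil>"
    \<comment> \<open>The last sample is clamped to \<open>b\<close>, so the last step may be
      shorter than 1.\<close>
    define \<tau> where "\<tau> i = min (a + real i) b" for i :: nat
    define x where "x i = \<beta> (\<tau> i)" for i
    have n: "b - a \<le> n" "n < b - a + 1" using ab by (auto simp: n_def) linarith+
    have \<tau>: "\<tau> i \<in> {a..b}" for i using ab by (auto simp: \<tau>_def)
    have up: "dist (\<beta> u) (\<beta> v) \<le> K" if "\<bar>u - v\<bar> \<le> 1" "u \<in> {a..b}" "v \<in> {a..b}" for u v
    proof -
      have "dist (\<beta> u) (\<beta> v) \<le> L * \<bar>u - v\<bar> + A"
        using qg that unfolding quasi_geodesic_on_def by blast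
      also have "\<dots> \<le> L * 1 + A" using that(1) L by (intro add_right_mono mult_left_mono) auto
      finally show ?thesis by (simp add: K_def)
    qed
    have step: "dist (x i) (x (Suc i)) \<le> K" for i
      unfolding x_def by (rule up[OF _ \<tau> \<tau>]) (auto simp: \<tau>_def)
    define m where "m = nat \<lfloor>t - a\<rfloor>"
    have m: "real m \<le> t - a" "t - a < real m + 1" using t by (auto simp: m_def)
    have "dist (\<beta> t) (x m) \<le> K"
      unfolding x_def by (rule up[OF _ t \<tau>]) (use m t in \<open>auto simp: \<tau>_def\<close>)
    then have tm: "infdist (\<beta> t) Y \<le> infdist (x m) Y + K"
      using infdist_triangle[of "\<beta> t" Y "x m"] by simp
    show ?thesis
    proof (cases "infdist (x m) Y \<le> R")
      case True
      then show ?thesis using tm KD by (simp add: M_def)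
    next
      case False
      have mn: "m \<le> n" using m n t by simp
      have R0: "0 \<le> R" using R K by simp
      have "\<tau> 0 = a" "\<tau> n = b" using ab n by (auto simp: \<tau>_def)
      then have "infdist (x 0) Y \<le> R" "infdist (x n) Y \<le> R"
        using end_in R0 by (auto simp: x_def)
      from this mn False obtain i j where ij: "i < m" "m < j" "j \<le> n"
        and low: "infdist (x i) Y \<le> R" "infdist (x j) Y \<le> R"
        and high: "\<And>u. \<lbrakk>i < u; u < j\<rbrakk> \<Longrightarrow> \<not> infdist (x u) Y \<le> R"
        by (rule nat_gap_around[of "\<lambda>i. infdist (x i) Y \<le> R"]) blast
      obtain p q where p: "p \<in> near_proj \<epsilon> Y (x i)" and q: "q \<in> near_proj \<epsilon> Y (x j)"
        using ne by (metis all_not_in_conv)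
      let ?S = "\<Sum>u=i..<j. dist (x u) (x (Suc u))"
      have "?S \<le> (\<Sum>u=i..<j. K)" by (intro sum_mono step)
      then have S: "?S \<le> K * real (j - i)" by (simp add: mult.commute)
      have "dist p q \<le> 6 * R + 4 * \<epsilon> + 6 * K + 4 * k * ?S"
        by (rule dist_near_proj_chain[where Y = Y])
          (use R K k e ne con ij low high step p q in \<open>auto simp: less_imp_le not_le\<close>)
      also have "4 * k * ?S \<le> 4 * k * (K * real (j - i))"
        using S k by (intro mult_left_mono) auto
      also have "\<dots> = real (j - i) / (2 * L)" using L K by (simp add: k_def)
      finally have pq: "dist p q \<le> 6 * R + 4 * \<epsilon> + 6 * K + real (j - i) / (2 * L)" by simp
      have "dist (x i) (x j) \<le> dist (x i) p + dist p q + dist (x j) q"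
        by (smt (verit) dist_commute dist_triangle)
      then have xij: "dist (x i) (x j) \<le> 8 * R + 6 * \<epsilon> + 6 * K + real (j - i) / (2 * L)"
        using near_projD(2)[OF p] near_projD(2)[OF q] low pq by simp
      \<comment> \<open>The loss of 1 is due to the clamped last step.\<close>
      have "real (j - i) - 1 \<le> \<bar>\<tau> i - \<tau> j\<bar>" using ij n by (auto simp: \<tau>_def of_nat_diff)
      then have "(real (j - i) - 1) / L \<le> \<bar>\<tau> i - \<tau> j\<bar> / L" using L by (simp add: divide_right_mono)
      also have "\<dots> - A \<le> dist (x i) (x j)"
        using qg \<tau> unfolding quasi_geodesic_on_def x_def by blast
      finally have "(real (j - i) - 1) / L - A \<le> dist (x i) (x j)" by simp
      with xij have "(real (j - i) - 1) / L \<le> (A + 8 * R + 6 * \<epsilon> + 6 * K) + real (j - i) / (2 * L)"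
        by simp
      then have "real (j - i) \<le> 2 + 2 * L * (A + 8 * R + 6 * \<epsilon> + 6 * K)"
        by (rule le_of_divide_le_half[OF L])
      also have "\<dots> \<le> D" using L by (simp add: D_def algebra_simps)
      finally have jD: "real (j - i) \<le> D" .
      have "dist (x i) (x m) \<le> (\<Sum>u=i..<m. dist (x u) (x (Suc u)))"
        using ij by (intro dist_le_sum_steps) auto
      also have "\<dots> \<le> (\<Sum>u=i..<m. K)" by (intro sum_mono step)
      also have "\<dots> = K * real (m - i)" by simp
      also have "\<dots> \<le> K * D" using jD ij K by (intro mult_left_mono) (auto simp: of_nat_diff)
      finally show ?thesis
        using tm low(1) infdist_triangle[of "x m" Y "x i"] by (simp add: M_def dist_commute)
    qed
  qed
  moreover have "0 \<le> M" using R K KD by (simp add: M_def)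
  ultimately show ?thesis by blast
qed

lemma sublinearly_contracting_imp_Morse:
  assumes "sublinearly_contracting Y"
  shows "Morse Y"
proof -
  define P where "P L A M \<longleftrightarrow> 0 \<le> M \<and> (\<forall>a b \<beta>. a \<le> b \<longrightarrow> quasi_geodesic_on L A {a..b} \<beta> \<longrightarrow>
      \<beta> a \<in> Y \<longrightarrow> \<beta> b \<in> Y \<longrightarrow> (\<forall>t\<in>{a..b}. infdist (\<beta> t) Y \<le> M))" for L A M :: real
  have ex: "\<exists>M. P L A M" if "1 \<le> L" "0 \<le> A" for L A
    using sublinearly_contracting_imp_bounded_quasi_geodesics[OF assms that] unfolding P_def .
  define \<mu> where "\<mu> L A = (SOME M. P L A M)" for L A
  have "P L A (\<mu> L A)" if "1 \<le> L" "0 \<le> A" for L A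
    unfolding \<mu>_def by (rule someI_ex[OF ex[OF that]])
  then show ?thesis unfolding Morse_def mu_Morse_def P_def by (intro exI[of _ \<mu>]) blast
qed

subsection \<open>Sublinear contraction implies superlinear divergence\<close>

text \<open>Uniform continuity makes the steps of a fine equidistant sampling small. The sample
  times are one of the lists in the supremum defining \<open>path_length\<close>, so the sum stays
  below \<open>V\<close>.\<close>

lemma path_discretization:
  fixes p :: "real \<Rightarrow> 'a::metric_space"
  assumes p: "path p" and V: "path_length p \<le> ereal V"
  obtains N where "0 < N"
    "\<And>i. i < N \<Longrightarrow> dist (p (real i / real N)) (p (real (Suc i) / real N)) \<le> 1"
    "(\<Sum>i<N. dist (p (real i / real N)) (p (real (Suc i) / real N))) \<le> V"
proof -
  have "uniformly_continuous_on {0..1} p"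
    using p unfolding path_def by (intro compact_uniformly_continuous) auto
  then obtain d where d: "0 < d" "\<And>u v. \<lbrakk>u \<in> {0..1}; v \<in> {0..1}; dist v u < d\<rbrakk> \<Longrightarrow> dist (p v) (p u) < 1"
    unfolding uniformly_continuous_on_def by (metis zero_less_one)
  obtain n :: nat where n: "inverse (real (Suc n)) < d" using reals_Archimedean[OF d(1)] by blast
  define N where "N = Suc n"
  define f where "f i = p (real i / real N)" for i
  have N: "0 < N" by (simp add: N_def)
  have step: "dist (f i) (f (Suc i)) \<le> 1" if "i < N" for i
  proof -
    have "real (Suc i) / real N - real i / real N = inverse (real N)"
      using N by (simp add: field_simps)
    then have "dist (real i / real N) (real (Suc i) / real N) = inverse (real N)"
      unfolding dist_real_def by (subst abs_minus_commute) simp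
    then have "dist (real i / real N) (real (Suc i) / real N) < d"
      using n by (simp add: N_def)
    then show ?thesis unfolding f_def
      using that by (intro less_imp_le d(2)) auto
  qed
  define ts where "ts = map (\<lambda>i. real i / real N) [0..<Suc N]"
  have "sorted ts" unfolding ts_def sorted_map
    by (rule sorted_wrt_mono_rel[OF _ sorted_upt]) (auto simp: divide_right_mono)
  moreover have "set ts \<subseteq> {0..1}" using N by (auto simp: ts_def)
  ultimately have "ereal (\<Sum>i<length ts - 1. dist (p (ts ! i)) (p (ts ! Suc i))) \<le> path_length p"
    unfolding path_length_def by (intro SUP_upper) simp
  moreover have "(\<Sum>i<length ts - 1. dist (p (ts ! i)) (p (ts ! Suc i))) = (\<Sum>i<N. dist (f i) (f (Suc i)))"
    unfolding f_def by (intro sum.cong) (auto simp: ts_def nth_append simp del: upt_Suc)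
  ultimately have "ereal (\<Sum>i<N. dist (f i) (f (Suc i))) \<le> ereal V" using V by (metis order.trans)
  then have "(\<Sum>i<N. dist (f i) (f (Suc i))) \<le> V" by simp
  with N step that show thesis unfolding f_def by blast
qed


text \<open>The infima over base points and paths need not be attained; the slack 1 makes the
  inequality strict and yields witnesses.\<close>

lemma divergence_leD:
  assumes "divergence \<gamma> L A l \<kappa> r \<le> ereal V"
  obtains s p where "path p" "pathstart p = \<gamma> (s - r)" "pathfinish p = \<gamma> (s + r)"
    "path_image p \<inter> ball (\<gamma> s) (l * (r / L - A) - \<kappa>) = {}" "path_length p \<le> ereal (V + 1)"
proof -
  have "divergence \<gamma> L A l \<kappa> r < ereal (V + 1)"
    using assms by (rule le_less_trans) simp
  then show thesis
    using that unfolding divergence_def avoiding_length_def INF_less_iff by (auto intro: less_imp_le)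
qed

text \<open>Projected to \<gamma>, a path around \<gamma>\<open>(s)\<close> must pass from
  parameters below \<open>s\<close> to parameters at least \<open>s\<close>. Since it avoids the
  ball, the excursion doing so jumps over a parameter interval of length proportional to
  \<open>r\<close>. Its projection moves by at most a constant plus \<open>4 * k\<close> times the
  path length, which is too little if that length is linear in \<open>r\<close> and \<open>k\<close>
  is small.\<close>

lemma sublinearly_contracting_imp_completely_superlinear:
  fixes \<gamma> :: "real \<Rightarrow> 'a::metric_space"
  assumes qg: "quasi_geodesic_on L A UNIV \<gamma>" and l: "0 < l"
    and Y: "sublinearly_contracting (range \<gamma>)"
  shows "completely_superlinear (divergence \<gamma> L A l \<kappa>)"
  unfolding completely_superlinear_def
proof (intro allI impI)
  fix C1 C2 C3 C4 :: real
  assume pos: "0 < C1" "0 < C2" "0 \<le> C3" "0 \<le> C4"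
  let ?Y = "range \<gamma>"
  from Y obtain \<epsilon> where e: "0 \<le> \<epsilon>" and ne: "\<And>x. near_proj \<epsilon> ?Y x \<noteq> {}"
    and C: "\<And>k R0. 0 < k \<Longrightarrow> \<exists>R\<ge>R0. \<forall>x x' p q. R \<le> infdist x ?Y \<longrightarrow> dist x x' \<le> infdist x ?Y \<longrightarrow>
      p \<in> near_proj \<epsilon> ?Y x \<longrightarrow> q \<in> near_proj \<epsilon> ?Y x' \<longrightarrow> dist p q \<le> k * infdist x ?Y"
    by (erule sublinearly_contractingD)
  have L: "1 \<le> L" and A: "0 \<le> A" using qg by (auto simp: quasi_geodesic_on_def)
  have lo: "\<bar>u - v\<bar> \<le> L * (dist (\<gamma> u) (\<gamma> v) + A)" for u v
  proof -
    have "\<bar>u - v\<bar> / L - A \<le> dist (\<gamma> u) (\<gamma> v)" using qg unfolding quasi_geodesic_on_def by blast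
    then show ?thesis using L by (simp add: field_simps)
  qed
  have up: "dist (\<gamma> u) (\<gamma> v) \<le> L * \<bar>u - v\<bar> + A" for u v
    using qg unfolding quasi_geodesic_on_def by blast
  define M where "M = C1 * C2"
  define M' where "M' = C1 * C3 + C4 + 1"
  have M: "0 < M" "0 \<le> M'" using pos by (auto simp: M_def M'_def)
  \<comment> \<open>This makes the coefficient of \<open>r\<close> in the final upper bound at most
    \<open>l / L\<close>, half of the one in the lower bound.\<close>
  define k where "k = min 1 (l / (4 * M * L ^ 3))"
  have k: "0 < k" "k \<le> 1" using M L l by (auto simp: k_def)
  have kM: "L\<^sup>2 * (4 * k * M) \<le> l / L"
  proof -
    have "k \<le> l / (4 * M * L ^ 3)" by (simp add: k_def)
    then show ?thesis using M L by (simp add: field_simps power2_eq_square power3_eq_cube)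
  qed
  from C[OF k(1), of 4] obtain R where R: "4 \<le> R" and
    con: "\<And>x x' p q. \<lbrakk>R \<le> infdist x ?Y; dist x x' \<le> infdist x ?Y; p \<in> near_proj \<epsilon> ?Y x;
       q \<in> near_proj \<epsilon> ?Y x'\<rbrakk> \<Longrightarrow> dist p q \<le> k * infdist x ?Y" by blast
  define E where "E = L\<^sup>2 * (A + 6 * R + 4 * \<epsilon> + 6 + 4 * k * M') + 2 * (l * A + \<kappa> + R + \<epsilon> + A)"
  \<comment> \<open>The first entry ensures that the end of the path does not project to the left of
    \<open>s\<close>; exceeding the second gives the final contradiction.\<close>
  define B where "B = max (L * (\<epsilon> + A)) (L * E / l)"
  have "r \<le> B" if r0: "0 \<le> r"
    and div: "divergence \<gamma> L A l \<kappa> r \<le> ereal (C1 * (C2 * r + C3) + C4)" for r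
  proof (rule ccontr)
    assume "\<not> r \<le> B"
    then have r: "L * (\<epsilon> + A) < r" "L * E / l < r" by (auto simp: B_def)
    have "0 \<le> L * (\<epsilon> + A)" using L e A by simp
    then have rpos: "0 < r" using r by linarith
    from divergence_leD[OF div] obtain s p where p: "path p" "pathstart p = \<gamma> (s - r)"
      "pathfinish p = \<gamma> (s + r)" "path_image p \<inter> ball (\<gamma> s) (l * (r / L - A) - \<kappa>) = {}"
      and "path_length p \<le> ereal (C1 * (C2 * r + C3) + C4 + 1)" .
    then have len: "path_length p \<le> ereal (M * r + M')" by (simp add: M_def M'_def algebra_simps)
    from path_discretization[OF p(1) len] obtain N where N: "0 < N"
      and step: "\<And>i. i < N \<Longrightarrow> dist (p (real i / real N)) (p (real (Suc i) / real N)) \<le> 1"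
      and total: "(\<Sum>i<N. dist (p (real i / real N)) (p (real (Suc i) / real N))) \<le> M * r + M'"
      by blast
    define x where "x i = p (real i / real N)" for i
    have x0: "x 0 = \<gamma> (s - r)" and xN: "x N = \<gamma> (s + r)"
      using p(2,3) N by (auto simp: x_def pathstart_def pathfinish_def)
    have far: "l * (r / L - A) - \<kappa> \<le> dist (\<gamma> s) (x i)" if "i \<le> N" for i
    proof -
      have "x i \<in> path_image p" using that N by (auto simp: x_def path_image_def)
      then show ?thesis using p(4) by (auto simp: disjoint_iff not_less)
    qed
    \<comment> \<open>One nearly closest point with parameter below \<open>s\<close> suffices.
      Hence, if a low sample is not \<open>left\<close>, all its projections have parameter at least
      \<open>s\<close>.\<close>
    define left where "left i \<longleftrightarrow> infdist (x i) ?Y \<le> R \<and> (\<exists>w<s. \<gamma> w \<in> near_proj \<epsilon> ?Y (x i))" for i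
    have left0: "left 0" unfolding left_def x0
      using rpos e R by (auto simp: near_proj_def intro!: exI[of _ "s - r"])
    have notleft: "\<not> left N"
    proof
      assume "left N"
      then obtain w where w: "w < s" "\<gamma> w \<in> near_proj \<epsilon> ?Y (\<gamma> (s + r))" by (auto simp: left_def xN)
      have "dist (\<gamma> (s + r)) (\<gamma> w) \<le> \<epsilon>" using near_projD(2)[OF w(2)] by simp
      then have "L * (dist (\<gamma> (s + r)) (\<gamma> w) + A) \<le> L * (\<epsilon> + A)" using L by simp
      then show False using lo[of "s + r" w] w(1) r(1) by simp
    qed
    define i where "i = (GREATEST i. left i \<and> i \<le> N)"
    have i: "left i \<and> i \<le> N" unfolding i_def
      by (rule GreatestI_nat[of "\<lambda>i. left i \<and> i \<le> N" 0 N]) (use left0 in auto)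
    have imax: "m \<le> i" if "left m" "m \<le> N" for m unfolding i_def
      using that by (intro Greatest_le_nat[of "\<lambda>i. left i \<and> i \<le> N" m N]) auto
    have iN: "i < N" using i notleft by (metis le_neq_implies_less)
    \<comment> \<open>The next low sample after the last \<open>left\<close> one: it is not
      \<open>left\<close>, and all samples in between are high, so the crossing happens between
      \<open>i\<close> and \<open>j\<close>.\<close>
    define j where "j = (LEAST j. i < j \<and> infdist (x j) ?Y \<le> R)"
    have lowN: "i < N \<and> infdist (x N) ?Y \<le> R" using iN R by (simp add: xN)
    have j: "i < j \<and> infdist (x j) ?Y \<le> R" unfolding j_def by (rule LeastI[of _ N]) (rule lowN)
    have jN: "j \<le> N" unfolding j_def by (rule Least_le) (rule lowN)
    have high: "R \<le> infdist (x m) ?Y" if "i < m" "m < j" for m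
      using not_less_Least[of m "\<lambda>j. i < j \<and> infdist (x j) ?Y \<le> R"] that
      unfolding j_def[symmetric] by auto
    from i obtain w where w: "w < s" "\<gamma> w \<in> near_proj \<epsilon> ?Y (x i)" and low_i: "infdist (x i) ?Y \<le> R"
      by (auto simp: left_def)
    obtain q where q: "q \<in> near_proj \<epsilon> ?Y (x j)" using ne by blast
    then obtain v where v: "\<gamma> v \<in> near_proj \<epsilon> ?Y (x j)" using near_projD(1)[OF q] by blast
    have "\<not> left j" using imax[of j] j jN by auto
    then have vs: "s \<le> v" using v j by (auto simp: left_def not_less[symmetric])
    let ?S = "\<Sum>u=i..<j. dist (x u) (x (Suc u))"
    have "?S \<le> (\<Sum>u<N. dist (x u) (x (Suc u)))" using jN by (intro sum_mono2) auto
    also have "\<dots> \<le> M * r + M'" using total by (simp add: x_def)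
    finally have S: "4 * k * ?S \<le> 4 * k * (M * r + M')" using k by (intro mult_left_mono) auto
    have d: "dist (\<gamma> w) (\<gamma> v) \<le> 6 * R + 4 * \<epsilon> + 6 * 1 + 4 * k * ?S"
      by (rule dist_near_proj_chain[where Y = ?Y])
        (use R k e ne con i j jN high low_i w v step in \<open>auto simp: x_def\<close>)
    \<comment> \<open>A low sample is within \<open>R + \<epsilon>\<close> of its projection but
      outside the ball around \<gamma>\<open>(s)\<close>, so the parameter of the projection is far
      from \<open>s\<close>.\<close>
    have away: "l * (r / L - A) - \<kappa> - R - \<epsilon> - A \<le> L * \<bar>u - s\<bar>"
      if "m \<le> N" "infdist (x m) ?Y \<le> R" "\<gamma> u \<in> near_proj \<epsilon> ?Y (x m)" for u m
      using far[OF that(1)] near_projD(2)[OF that(3)] that(2) up[of u s]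
        dist_triangle[of "\<gamma> s" "x m" "\<gamma> u"] by (simp add: dist_commute)
    have "L * (v - w) = L * \<bar>w - s\<bar> + L * \<bar>v - s\<bar>" using w vs by (simp add: algebra_simps)
    then have "2 * (l * (r / L - A) - \<kappa> - R - \<epsilon> - A) \<le> L * (v - w)"
      using away[of i w] away[of j v] i j jN low_i w v by argo
    also have "\<dots> \<le> L * (L * (dist (\<gamma> w) (\<gamma> v) + A))"
      using lo[of v w] L vs w by (intro mult_left_mono) (auto simp: dist_commute)
    also have "\<dots> \<le> L * (L * (6 * R + 4 * \<epsilon> + 6 + 4 * k * (M * r + M') + A))"
      using d S L by (intro mult_left_mono) auto
    also have "\<dots> = L\<^sup>2 * (A + 6 * R + 4 * \<epsilon> + 6 + 4 * k * M') + L\<^sup>2 * (4 * k * M) * r"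
      by (simp add: algebra_simps power2_eq_square)
    also have "\<dots> \<le> L\<^sup>2 * (A + 6 * R + 4 * \<epsilon> + 6 + 4 * k * M') + l / L * r"
      using kM r0 by (intro add_left_mono mult_right_mono)
    finally have "2 * (l * (r / L - A) - \<kappa> - R - \<epsilon> - A) \<le>
      L\<^sup>2 * (A + 6 * R + 4 * \<epsilon> + 6 + 4 * k * M') + l / L * r" .
    moreover have "2 * (l * (r / L - A) - \<kappa> - R - \<epsilon> - A) =
      2 * (l / L * r) - 2 * (l * A + \<kappa> + R + \<epsilon> + A)"
      by (simp add: algebra_simps)
    ultimately have "l / L * r \<le> E" by (simp add: E_def)
    then have "r \<le> L * E / l" using l L by (simp add: field_simps)
    with r(2) show False by simp
  qed
  then show "bounded {r. 0 \<le> r \<and> divergence \<gamma> L A l \<kappa> r \<le> ereal (C1 * (C2 * r + C3) + C4)}"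
    by (intro boundedI[of _ B]) auto
qed

subsection \<open>Short-cutting corners\<close>

lemma geodesic_obtain:
  fixes x y :: "'a::geodesic_metric_space"
  obtains g where "g 0 = x" "g (dist x y) = y"
    "\<And>s t. \<lbrakk>0 \<le> s; s \<le> dist x y; 0 \<le> t; t \<le> dist x y\<rbrakk> \<Longrightarrow> dist (g s) (g t) = \<bar>s - t\<bar>"
  using ex_geodesic[of x y] by auto

text \<open>A gap of fixed proportion between the ball and the set keeps the whole geodesic from
  \<open>x\<close> to \<open>x'\<close> far from the set. If the geodesic leaves the smaller ball at \<open>z\<close>, then its remaining part
  is short, and it is either contained in a ball around \<open>z\<close> of the same kind or close to the set.\<close>

lemma sublinearly_contractingI_smaller_balls:
  fixes Y :: "'a::geodesic_metric_space set"
  assumes ne: "Y \<noteq> {}"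
    and small: "\<And>c. \<lbrakk>0 < c; c \<le> 1 / 2\<rbrakk> \<Longrightarrow> \<exists>N. \<forall>x x' p q. N \<le> infdist x Y \<longrightarrow>
      dist x x' \<le> (1 - c) * infdist x Y \<longrightarrow>
      p \<in> near_proj 1 Y x \<longrightarrow> q \<in> near_proj 1 Y x' \<longrightarrow> dist p q \<le> c * infdist x Y"
  shows "sublinearly_contracting Y"
proof (rule sublinearly_contractingI[OF ne])
  fix c0 :: real assume c0: "0 < c0"
  \<comment> \<open>The distance from \<open>p\<close> to \<open>w\<close> costs
    \<open>c * r\<close> and that from \<open>w\<close> to \<open>q\<close> at most
    \<open>7 * (c * r)\<close>.\<close>
  define c where "c = min (1 / 2) (c0 / 8)"
  have c: "0 < c" "c \<le> 1 / 2" "8 * c \<le> c0" using c0 by (auto simp: c_def)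
  from small[OF c(1,2)] obtain N where N: "\<And>x x' p q. \<lbrakk>N \<le> infdist x Y;
      dist x x' \<le> (1 - c) * infdist x Y; p \<in> near_proj 1 Y x; q \<in> near_proj 1 Y x'\<rbrakk>
      \<Longrightarrow> dist p q \<le> c * infdist x Y" by blast
  \<comment> \<open>The second entry lets contraction apply again at \<open>z\<close> once its
    height is \<open>2 * (c * r)\<close>; the third absorbs the constant 2 of the crude bound into
    \<open>c * r\<close>.\<close>
  define N' where "N' = max N (max (N / (2 * c)) (2 / c))"
  have "dist p q \<le> c0 * infdist x Y"
    if r: "N' \<le> infdist x Y" and d: "dist x x' \<le> infdist x Y"
      and p: "p \<in> near_proj 1 Y x" and q: "q \<in> near_proj 1 Y x'" for x x' p q
  proof -
    define r where "r = infdist x Y"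
    have rN: "N \<le> r" "N / (2 * c) \<le> r" "2 / c \<le> r" using r by (auto simp: N'_def r_def)
    then have r2: "N \<le> 2 * (c * r)" "2 \<le> c * r" using c by (auto simp: field_simps)
    have r0: "0 \<le> r" by (simp add: r_def infdist_nonneg)
    have c0r: "8 * (c * r) \<le> c0 * r" using mult_right_mono[OF c(3) r0] by simp
    show ?thesis
    proof (cases "dist x x' \<le> (1 - c) * r")
      case True
      then show ?thesis using N[of x x' p q] rN p q c0r r2 unfolding r_def by linarith
    next
      case False
      obtain g where g: "g 0 = x" "g (dist x x') = x'"
        "\<And>s t. \<lbrakk>0 \<le> s; s \<le> dist x x'; 0 \<le> t; t \<le> dist x x'\<rbrakk> \<Longrightarrow> dist (g s) (g t) = \<bar>s - t\<bar>"
        by (rule geodesic_obtain) blast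
      define u where "u = (1 - c) * r"
      have u: "0 \<le> u" "u \<le> dist x x'" using c r0 False by (auto simp: u_def)
      define z where "z = g u"
      have xz: "dist x z = u" using g(3)[of 0 u] u by (simp add: z_def g)
      have zx': "dist z x' \<le> c * r"
        using g(3)[of u "dist x x'"] u d by (simp add: z_def g u_def r_def algebra_simps)
      obtain w where w: "w \<in> near_proj 1 Y z" using near_proj_nonempty[OF ne, of 1 z] by auto
      have pw: "dist p w \<le> c * r"
        unfolding r_def by (rule N[OF _ _ p w]) (use rN xz in \<open>auto simp: u_def r_def\<close>)
      have "dist w q \<le> 7 * (c * r)"
      proof (cases "2 * (c * r) \<le> infdist z Y")
        case True
        have "infdist z Y * c \<le> infdist z Y * (1 / 2)"
          using c by (intro mult_left_mono) (auto simp: infdist_nonneg)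
        then have "(1 - c) * infdist z Y \<ge> infdist z Y / 2" by (simp add: algebra_simps)
        then have "dist z x' \<le> (1 - c) * infdist z Y" using zx' True by linarith
        then have "dist w q \<le> c * infdist z Y" using N[OF _ _ w q] True r2 by linarith
        also have "\<dots> \<le> c * (2 * r)"
        proof (rule mult_left_mono)
          have "u \<le> r" using c r0 by (simp add: u_def algebra_simps)
          then show "infdist z Y \<le> 2 * r"
            using infdist_triangle[of z Y x] xz by (simp add: dist_commute r_def)
        qed (use c in simp)
        finally show ?thesis using r2 by simp
      next
        case False
        then show ?thesis using dist_near_proj_le[OF w q] zx' r2 by linarith
      qed
      then show ?thesis using pw dist_triangle[of p q w] c0r unfolding r_def by linarith
    qed
  qed
  then show "\<exists>N. \<forall>x x' p q. N \<le> infdist x Y \<longrightarrow> dist x x' \<le> infdist x Y \<longrightarrow>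
      p \<in> near_proj 1 Y x \<longrightarrow> q \<in> near_proj 1 Y x' \<longrightarrow> dist p q \<le> c0 * infdist x Y"
    by blast
qed

text \<open>A quasi-geodesic with multiplicative lower constant \<eta> and additive loss fixed at 1.
  \<open>expanding_path_shortcut\<close> preserves both, so corners can be cut one after
  another.\<close>

definition expanding_path :: "real \<Rightarrow> real \<Rightarrow> (real \<Rightarrow> 'a::metric_space) \<Rightarrow> bool" where
  "expanding_path \<eta> T f \<longleftrightarrow> 0 \<le> T \<and> 1-lipschitz_on {0..T} f \<and>
     (\<forall>s t. 0 \<le> s \<longrightarrow> s \<le> t \<longrightarrow> t \<le> T \<longrightarrow> \<eta> * (t - s) - 1 \<le> dist (f s) (f t))"

lemma expanding_pathD:
  assumes "expanding_path \<eta> T f"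
  shows "0 \<le> T" "1-lipschitz_on {0..T} f"
    "\<And>s t. \<lbrakk>0 \<le> s; s \<le> t; t \<le> T\<rbrakk> \<Longrightarrow> \<eta> * (t - s) - 1 \<le> dist (f s) (f t)"
  using assms by (auto simp: expanding_path_def)

lemma expanding_path_geodesic:
  assumes "\<eta> \<le> 1" "0 \<le> T"
    "\<And>s t. \<lbrakk>0 \<le> s; s \<le> T; 0 \<le> t; t \<le> T\<rbrakk> \<Longrightarrow> dist (g s) (g t) = \<bar>s - t\<bar>"
  shows "expanding_path \<eta> T g"
proof -
  have "\<eta> * (t - s) - 1 \<le> dist (g s) (g t)" if "0 \<le> s" "s \<le> t" "t \<le> T" for s t
    using assms(3)[of s t] that mult_right_mono[OF assms(1), of "t - s"] by simp
  moreover have "1-lipschitz_on {0..T} g"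
    using assms(3) by (intro lipschitz_onI) (auto simp: dist_real_def)
  ultimately show ?thesis using assms(2) by (auto simp: expanding_path_def)
qed

lemma expanding_path_quasi_geodesic:
  assumes f: "expanding_path \<eta> T f" and \<eta>: "0 < \<eta>" "\<eta> \<le> 1"
  shows "quasi_geodesic_on (1 / \<eta>) 1 {0..T} f"
proof -
  have "\<eta> * \<bar>s - t\<bar> - 1 \<le> dist (f s) (f t)" if "s \<in> {0..T}" "t \<in> {0..T}" for s t
    using expanding_pathD(3)[OF f, of s t] expanding_pathD(3)[OF f, of t s] that
    by (cases "s \<le> t") (auto simp: dist_commute abs_if)
  moreover have "dist (f s) (f t) \<le> 1 / \<eta> * \<bar>s - t\<bar> + 1" if "s \<in> {0..T}" "t \<in> {0..T}" for s t
  proof -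
    have "dist (f s) (f t) \<le> 1 * \<bar>s - t\<bar>"
      using lipschitz_onD[OF expanding_pathD(2)[OF f] that] by (simp add: dist_real_def)
    also have "\<dots> \<le> 1 / \<eta> * \<bar>s - t\<bar>" using \<eta> by (intro mult_right_mono) auto
    finally show ?thesis by simp
  qed
  ultimately show ?thesis
    using \<eta> unfolding quasi_geodesic_on_def by (auto simp: is_interval_cc mult.commute)
qed

text \<open>The error 1 matches the additive loss granted by \<open>expanding_path\<close>.\<close>

lemma approximate_minimizer:
  fixes F :: "'b \<Rightarrow> real"
  assumes "S \<noteq> {}" "\<And>x. x \<in> S \<Longrightarrow> m \<le> F x"
  obtains x where "x \<in> S" "\<And>y. y \<in> S \<Longrightarrow> F x \<le> F y + 1"
proof -
  have "Inf (F ` S) < Inf (F ` S) + 1" by simp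
  then have "\<exists>z\<in>F ` S. z < Inf (F ` S) + 1" using assms(1) by (intro cInf_lessD) auto
  then obtain x where x: "x \<in> S" "F x < Inf (F ` S) + 1" by blast
  have "bdd_below (F ` S)" using assms(2) by (rule bdd_belowI2)
  then have "Inf (F ` S) \<le> F y" if "y \<in> S" for y using that by (intro cINF_lower)
  with x that show thesis by fastforce
qed

text \<open>The geodesic from \<alpha>\<open>(s)\<close> to \<beta>\<open>(t)\<close> replaces the
  corner, where \<open>(s, t)\<close> nearly minimises the distance minus \<eta> times the removed
  parameter length \<open>a - s + t\<close>. Near minimality says that points on both sides of the
  cut satisfy the expansion inequality; comparison with the pair \<open>(a, 0)\<close> bounds
  \<open>j\<close>.\<close>

lemma expanding_path_shortcut:
  fixes \<alpha> \<beta> :: "real \<Rightarrow> 'a::geodesic_metric_space"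
  assumes \<alpha>: "expanding_path \<eta> a \<alpha>" and \<beta>: "expanding_path \<eta> b \<beta>" and \<eta>: "0 < \<eta>" "\<eta> \<le> 1"
  obtains s t j \<omega> where "0 \<le> s" "s \<le> a" "0 \<le> t" "t \<le> b" "j = dist (\<alpha> s) (\<beta> t)"
    "j \<le> dist (\<alpha> a) (\<beta> 0) + \<eta> * (a - s + t) + 1"
    "expanding_path \<eta> (s + j + (b - t)) \<omega>"
    "\<And>v. v \<le> s \<Longrightarrow> \<omega> v = \<alpha> v" "\<omega> (s + j) = \<beta> t" "\<omega> (s + j + (b - t)) = \<beta> b"
proof -
  note a = expanding_pathD[OF \<alpha>] and b = expanding_pathD[OF \<beta>]
  define F where "F = (\<lambda>(s, t). dist (\<alpha> s) (\<beta> t) + \<eta> * s - \<eta> * t)"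
  have low: "- (\<eta> * b) \<le> F z" if z: "z \<in> {0..a} \<times> {0..b}" for z
  proof -
    obtain s t where st: "z = (s, t)" "0 \<le> s" "0 \<le> t" "t \<le> b" using z by auto
    have "\<eta> * t \<le> \<eta> * b" "0 \<le> \<eta> * s" using st \<eta> by (auto intro: mult_left_mono)
    moreover have "F z = dist (\<alpha> s) (\<beta> t) + \<eta> * s - \<eta> * t" by (simp add: F_def st(1))
    ultimately show ?thesis using zero_le_dist[of "\<alpha> s" "\<beta> t"] by linarith
  qed
  obtain z where z: "z \<in> {0..a} \<times> {0..b}" and zmin: "\<And>y. y \<in> {0..a} \<times> {0..b} \<Longrightarrow> F z \<le> F y + 1"
    by (rule approximate_minimizer[of "{0..a} \<times> {0..b}" "- (\<eta> * b)" F])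
      (use a(1) b(1) low in auto)
  obtain s t where zst: "z = (s, t)" by (cases z)
  with z have st: "0 \<le> s" "s \<le> a" "0 \<le> t" "t \<le> b" by auto
  define j where "j = dist (\<alpha> s) (\<beta> t)"
  have j0: "0 \<le> j" by (simp add: j_def)
  have min: "j + \<eta> * s - \<eta> * t \<le> dist (\<alpha> s') (\<beta> t') + \<eta> * s' - \<eta> * t' + 1"
    if "0 \<le> s'" "s' \<le> a" "0 \<le> t'" "t' \<le> b" for s' t'
    using zmin[of "(s', t')"] that by (simp add: F_def zst j_def)
  have across: "\<eta> * (s - s' + j + (t' - t)) - 1 \<le> dist (\<alpha> s') (\<beta> t') - (1 - \<eta>) * j"
    if "0 \<le> s'" "s' \<le> s" "t \<le> t'" "t' \<le> b" for s' t'
    using min[of s' t'] that st by (simp add: algebra_simps)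
  obtain g where g: "g 0 = \<alpha> s" "g j = \<beta> t"
    "\<And>u v. \<lbrakk>0 \<le> u; u \<le> j; 0 \<le> v; v \<le> j\<rbrakk> \<Longrightarrow> dist (g u) (g v) = \<bar>u - v\<bar>"
    unfolding j_def by (rule geodesic_obtain) blast
  define T where "T = s + j + (b - t)"
  define \<omega> where "\<omega> = (\<lambda>v. if v \<le> s then \<alpha> v else if v \<le> s + j then g (v - s) else \<beta> (v - s - j + t))"
  have T: "0 \<le> T" "s + j \<le> T" using st j0 by (auto simp: T_def)
  have w1: "\<omega> v = \<alpha> v" if "v \<le> s" for v using that by (simp add: \<omega>_def)
  \<comment> \<open>The three pieces agree where they meet, so each formula holds on a closed
    interval, also if \<open>j = 0\<close>.\<close>
  have w2: "\<omega> v = g (v - s)" if "s \<le> v" "v \<le> s + j" for v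
    using that g(1) by (cases "v = s") (auto simp: \<omega>_def)
  have w3: "\<omega> v = \<beta> (v - s - j + t)" if "s + j \<le> v" for v
    using that g j0 by (cases "v = s + j"; cases "j = 0") (auto simp: \<omega>_def)
  have "1-lipschitz_on {0..T} \<omega>"
    unfolding \<omega>_def
  proof (intro lipschitz_on_concat)
    show "1-lipschitz_on {0..s} \<alpha>" using a(2) st by (auto intro: lipschitz_on_subset)
    show "1-lipschitz_on {s..s + j} (\<lambda>v. g (v - s))"
      using g(3) by (intro lipschitz_onI) (auto simp: dist_real_def)
    show "1-lipschitz_on {s + j..T} (\<lambda>v. \<beta> (v - s - j + t))"
    proof (rule lipschitz_onI)
      fix u v assume "u \<in> {s + j..T}" "v \<in> {s + j..T}"
      then show "dist (\<beta> (u - s - j + t)) (\<beta> (v - s - j + t)) \<le> 1 * dist u v"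
        using lipschitz_onD[OF b(2), of "u - s - j + t" "v - s - j + t"] st
        by (auto simp: T_def dist_real_def)
    qed simp
    show "g (s + j - s) = \<beta> (s + j - s - j + t)" using g by simp
    show "\<alpha> s = (if s \<le> s + j then g (s - s) else \<beta> (s - s - j + t))" using g j0 by simp
  qed
  moreover have "\<eta> * (v - u) - 1 \<le> dist (\<omega> u) (\<omega> v)" if uv: "0 \<le> u" "u \<le> v" "v \<le> T" for u v
  proof -
    have shrink: "\<eta> * x \<le> x" if "0 \<le> x" for x using mult_right_mono[OF \<eta>(2) that] by simp
    consider "v \<le> s" | "u \<le> s" "s \<le> v" "v \<le> s + j" | "u \<le> s" "s + j \<le> v"
      | "s \<le> u" "v \<le> s + j" | "s \<le> u" "u \<le> s + j" "s + j \<le> v" | "s + j \<le> u"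
      by linarith
    then show ?thesis
    proof cases
      case 1
      then show ?thesis using w1[of u] w1[of v] a(3)[of u v] uv st by simp
    next
      \<comment> \<open>The lower bound is taken at the far end \<beta>\<open>(t)\<close> of the
        geodesic; subtracting the remaining length \<open>s + j - v\<close> leaves
        \<open>v - s\<close>. Case 5 is the mirror image.\<close>
      case 2
      have "dist (g (v - s)) (\<beta> t) = s + j - v" using g(2) g(3)[of "v - s" j] 2 by simp
      then have "dist (\<alpha> u) (\<beta> t) \<le> dist (\<omega> u) (\<omega> v) + (s + j - v)"
        using w1[of u] w2[of v] 2 dist_triangle[of "\<alpha> u" "\<beta> t" "g (v - s)"] by simp
      moreover have "j + \<eta> * (s - u) - 1 \<le> dist (\<alpha> u) (\<beta> t)"
        using min[of u t] uv 2 st by (simp add: algebra_simps)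
      moreover have "\<eta> * (v - u) = \<eta> * (s - u) + \<eta> * (v - s)" by (simp add: algebra_simps)
      ultimately show ?thesis using shrink[of "v - s"] 2 by linarith
    next
      case 3
      have "j + \<eta> * (s - u) + \<eta> * (v - s - j) - 1 \<le> dist (\<omega> u) (\<omega> v)"
        using min[of u "v - s - j + t"] uv 3 st w1[of u] w3[of v] by (simp add: algebra_simps T_def)
      moreover have "\<eta> * (v - u) = \<eta> * (s - u) + \<eta> * j + \<eta> * (v - s - j)"
        by (simp add: algebra_simps)
      ultimately show ?thesis using shrink[OF j0] by linarith
    next
      case 4
      then show ?thesis using w2[of u] w2[of v] uv g(3)[of "u - s" "v - s"] shrink[of "v - u"] by simp
    next
      case 5
      have "dist (\<alpha> s) (g (u - s)) = u - s" using g(1) g(3)[of 0 "u - s"] 5 by simp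
      then have "dist (\<alpha> s) (\<beta> (v - s - j + t)) \<le> dist (\<omega> u) (\<omega> v) + (u - s)"
        using w2[of u] w3[of v] 5 dist_triangle[of "\<alpha> s" "\<beta> (v - s - j + t)" "g (u - s)"] by simp
      moreover have "j + \<eta> * (v - s - j) - 1 \<le> dist (\<alpha> s) (\<beta> (v - s - j + t))"
        using min[of s "v - s - j + t"] uv 5 st by (simp add: algebra_simps T_def)
      moreover have "\<eta> * (v - u) = \<eta> * (v - s - j) + \<eta> * (s + j - u)" by (simp add: algebra_simps)
      ultimately show ?thesis using shrink[of "s + j - u"] 5 by linarith
    next
      case 6
      then show ?thesis
        using w3[of u] w3[of v] uv b(3)[of "u - s - j + t" "v - s - j + t"] st by (simp add: T_def)
    qed
  qed
  ultimately have "expanding_path \<eta> T \<omega>" using T by (simp add: expanding_path_def)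
  moreover have "j \<le> dist (\<alpha> a) (\<beta> 0) + \<eta> * (a - s + t) + 1"
    using min[of a 0] a(1) b(1) by (simp add: algebra_simps)
  moreover have "\<omega> (s + j) = \<beta> t" "\<omega> T = \<beta> b" using w3[of "s + j"] w3[OF T(2)] by (auto simp: T_def)
  ultimately show thesis using that[of s t j \<omega>] st w1 by (simp add: j_def T_def)
qed

subsection \<open>Morse implies sublinear contraction\<close>

text \<open>If two points of a ball disjoint from \<open>Y\<close> have distant projections \<open>p\<close> and \<open>q\<close>, then cutting the two
  corners of the path formed by three geodesics, from \<open>p\<close> up to the ball, across it, and down to \<open>q\<close>,
  gives a quasi-geodesic. Its constants do not depend on the size of the ball, and its height is
  proportional to that size.\<close>

lemma Morse_imp_sublinearly_contracting:
  fixes Y :: "'a::geodesic_metric_space set"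
  assumes ne: "Y \<noteq> {}" and Y: "Morse Y"
  shows "sublinearly_contracting Y"
proof (rule sublinearly_contractingI_smaller_balls[OF ne])
  fix c :: real assume c: "0 < c" "c \<le> 1 / 2"
  \<comment> \<open>The two cuts will have lengths at most \<open>3 * (\<eta> * r) + 1\<close> and
    \<open>9 * (\<eta> * r) + 1\<close>, both well below \<open>c * r\<close> for large
    \<open>r\<close>.\<close>
  define \<eta> where "\<eta> = c / 40"
  have \<eta>: "0 < \<eta>" "\<eta> \<le> 1" using c by (auto simp: \<eta>_def)
  obtain \<mu> where \<mu>: "\<forall>L\<ge>1. \<forall>A\<ge>0. \<mu> L A \<ge> 0" "mu_Morse \<mu> Y" using Y by (auto simp: Morse_def)
  define B where "B = \<mu> (1 / \<eta>) 1"
  have B0: "0 \<le> B" using \<mu>(1) \<eta> by (simp add: B_def)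
  have B: "infdist (\<omega> v) Y \<le> B"
    if "expanding_path \<eta> T \<omega>" "\<omega> 0 \<in> Y" "\<omega> T \<in> Y" "0 \<le> v" "v \<le> T" for T \<omega> v
  proof -
    have "1 \<le> 1 / \<eta>" using \<eta> by simp
    then show ?thesis
      using \<mu>(2)[unfolded mu_Morse_def, rule_format, of "1 / \<eta>" 1 0 T \<omega> v]
        expanding_path_quasi_geodesic[OF that(1) \<eta>] that
      by (simp add: B_def)
  qed
  define N where "N = max 2 (4 * (B + 2) / c)"
  have "dist p q \<le> c * infdist x Y"
    if r: "N \<le> infdist x Y" and xy: "dist x y \<le> (1 - c) * infdist x Y"
      and p: "p \<in> near_proj 1 Y x" and q: "q \<in> near_proj 1 Y y" for x y p q
  proof (rule ccontr)
    assume neg: "\<not> dist p q \<le> c * infdist x Y"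
    define r where "r = infdist x Y"
    have pq: "c * r < dist p q" using neg by (simp add: r_def)
    have r2: "2 \<le> r" and rB: "4 * (B + 2) \<le> c * r"
      using r c by (auto simp: N_def r_def field_simps)
    have "0 \<le> c * r" using c r2 by simp
    then have xy_r: "dist x y \<le> r - c * r" "dist x y \<le> r" using xy by (auto simp: r_def algebra_simps)
    define l1 l2 l3 where "l1 = dist p x" and "l2 = dist x y" and "l3 = dist y q"
    have l1: "0 \<le> l1" "l1 \<le> r + 1" using near_projD(2)[OF p] by (auto simp: l1_def r_def dist_commute)
    have l3: "0 \<le> l3" "l3 \<le> infdist y Y + 1" using near_projD(2)[OF q] by (auto simp: l3_def)
    have "infdist y Y \<le> 2 * r" using infdist_triangle[of y Y x] xy_r by (simp add: r_def dist_commute)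
    then have l3r: "l3 \<le> 2 * r + 1" using l3 by simp
    have l2: "0 \<le> l2" "l2 \<le> r" using xy_r by (auto simp: l2_def)
    obtain \<sigma> where \<sigma>: "\<sigma> 0 = p" "\<sigma> l1 = x"
      "\<And>s t. \<lbrakk>0 \<le> s; s \<le> l1; 0 \<le> t; t \<le> l1\<rbrakk> \<Longrightarrow> dist (\<sigma> s) (\<sigma> t) = \<bar>s - t\<bar>"
      unfolding l1_def by (rule geodesic_obtain) blast
    obtain \<beta> where \<beta>: "\<beta> 0 = x" "\<beta> l2 = y"
      "\<And>s t. \<lbrakk>0 \<le> s; s \<le> l2; 0 \<le> t; t \<le> l2\<rbrakk> \<Longrightarrow> dist (\<beta> s) (\<beta> t) = \<bar>s - t\<bar>"
      unfolding l2_def by (rule geodesic_obtain) blast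
    obtain \<tau> where \<tau>: "\<tau> 0 = y" "\<tau> l3 = q"
      "\<And>s t. \<lbrakk>0 \<le> s; s \<le> l3; 0 \<le> t; t \<le> l3\<rbrakk> \<Longrightarrow> dist (\<tau> s) (\<tau> t) = \<bar>s - t\<bar>"
      unfolding l3_def by (rule geodesic_obtain) blast
    have exp: "expanding_path \<eta> l1 \<sigma>" "expanding_path \<eta> l2 \<beta>" "expanding_path \<eta> l3 \<tau>"
      using expanding_path_geodesic \<eta> l1 l2 l3 \<sigma>(3) \<beta>(3) \<tau>(3) by auto
    obtain s0 u0 j1 \<omega>1 where s0: "0 \<le> s0" "s0 \<le> l1" and u0: "0 \<le> u0" "u0 \<le> l2"
      and j1: "j1 = dist (\<sigma> s0) (\<beta> u0)" "j1 \<le> dist (\<sigma> l1) (\<beta> 0) + \<eta> * (l1 - s0 + u0) + 1"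
      and e1: "expanding_path \<eta> (s0 + j1 + (l2 - u0)) \<omega>1"
      and \<omega>1: "\<And>v. v \<le> s0 \<Longrightarrow> \<omega>1 v = \<sigma> v" "\<omega>1 (s0 + j1 + (l2 - u0)) = \<beta> l2"
      by (rule expanding_path_shortcut[OF exp(1,2) \<eta>]) blast
    define T1 where "T1 = s0 + j1 + (l2 - u0)"
    obtain s2 t2 j2 \<omega>2 where s2: "0 \<le> s2" "s2 \<le> T1" and t2: "0 \<le> t2" "t2 \<le> l3"
      and j2: "j2 = dist (\<omega>1 s2) (\<tau> t2)" "j2 \<le> dist (\<omega>1 T1) (\<tau> 0) + \<eta> * (T1 - s2 + t2) + 1"
      and e2: "expanding_path \<eta> (s2 + j2 + (l3 - t2)) \<omega>2"
      and \<omega>2: "\<And>v. v \<le> s2 \<Longrightarrow> \<omega>2 v = \<omega>1 v" "\<omega>2 (s2 + j2) = \<tau> t2" "\<omega>2 (s2 + j2 + (l3 - t2)) = \<tau> l3"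
      by (rule expanding_path_shortcut[OF e1[folded T1_def] exp(3) \<eta>]) blast
    have low: "infdist (\<omega>2 v) Y \<le> B" if "0 \<le> v" "v \<le> s2 + j2 + (l3 - t2)" for v
    proof (rule B[OF e2 _ _ that])
      show "\<omega>2 0 \<in> Y" using \<omega>2(1) \<omega>1(1) \<sigma>(1) s0 s2 near_projD(1)[OF p] by simp
      show "\<omega>2 (s2 + j2 + (l3 - t2)) \<in> Y" using \<omega>2(3) \<tau>(2) near_projD(1)[OF q] by simp
    qed
    have j0: "0 \<le> j1" "0 \<le> j2" by (auto simp: j1 j2)
    have "\<eta> * (l1 - s0 + u0) \<le> \<eta> * (3 * r)"
      using \<eta> l1 l2 s0 u0 r2 by (intro mult_left_mono) auto
    then have j1r: "j1 \<le> 3 * (\<eta> * r) + 1" using j1(2) \<sigma>(2) \<beta>(1) by simp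
    also have "\<dots> \<le> 3 * (1 * r) + 1" using \<eta> r2 by simp
    finally have "T1 \<le> 6 * r" using s0 l1 l2 u0 r2 by (simp add: T1_def)
    then have "\<eta> * (T1 - s2 + t2) \<le> \<eta> * (9 * r)"
      using \<eta> l3r s2 t2 r2 by (intro mult_left_mono) auto
    then have j2r: "j2 \<le> 9 * (\<eta> * r) + 1" using j2(2) \<omega>1(2) \<beta>(2) \<tau>(1) by (simp add: T1_def)
    have \<eta>r: "\<eta> * r = c * r / 40" by (simp add: \<eta>_def)
    show False
    proof (cases "s0 \<le> s2")
      \<comment> \<open>The start \<sigma>\<open>(s0)\<close> of the first cut survives in
        \<open>\<omega>2\<close> and is thus close to \<open>Y\<close>. The other end
        \<beta>\<open>(u0)\<close> lies in the ball of radius \<open>(1 - c) * r\<close> around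
        \<open>x\<close>, hence at height at least \<open>c * r\<close>, too far for a cut of length
        \<open>j1\<close>.\<close>
      case True
      then have "infdist (\<sigma> s0) Y \<le> B" using low[of s0] \<omega>2(1) \<omega>1(1) s0 j0 t2 by simp
      moreover have "infdist (\<beta> u0) Y \<le> infdist (\<sigma> s0) Y + j1"
        using infdist_triangle[of "\<beta> u0" Y "\<sigma> s0"] by (simp add: j1 dist_commute)
      moreover have "r \<le> infdist (\<beta> u0) Y + u0"
        using infdist_triangle[of x Y "\<beta> u0"] \<beta>(3)[of 0 u0] \<beta>(1) u0 by (simp add: r_def)
      moreover have "u0 \<le> r - c * r" using u0 xy_r by (simp add: l2_def)
      ultimately show False using j1r \<eta>r rB B0 by argo
    next
      \<comment> \<open>The second cut has removed the first and leads from \<sigma> directly to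
        \<tau>. Its ends are close to \<open>Y\<close>, hence close to \<open>p\<close> and
        \<open>q\<close>, because \<sigma> and \<tau> are nearly shortest connections to
        \<open>Y\<close>. So \<open>p\<close> and \<open>q\<close> are too close together.\<close>
      case False
      then have \<omega>s2: "\<omega>2 s2 = \<sigma> s2" using \<omega>2(1) \<omega>1(1) by simp
      then have "infdist (\<sigma> s2) Y \<le> B" using low[of s2] s2 j0 t2 by simp
      moreover have "r \<le> infdist (\<sigma> s2) Y + (l1 - s2)"
        using infdist_triangle[of x Y "\<sigma> s2"] \<sigma>(2) \<sigma>(3)[of l1 s2] s2 False s0 by (simp add: r_def)
      moreover have "infdist (\<tau> t2) Y \<le> B" using low[of "s2 + j2"] \<omega>2(2) s2 j0 t2 by simp
      moreover have "infdist y Y \<le> infdist (\<tau> t2) Y + t2"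
        using infdist_triangle[of y Y "\<tau> t2"] \<tau>(1) \<tau>(3)[of 0 t2] t2 by simp
      moreover have "dist p (\<sigma> s2) = s2" using \<sigma>(1) \<sigma>(3)[of 0 s2] s2 False s0 by simp
      moreover have "dist (\<tau> t2) q = l3 - t2" using \<tau>(2) \<tau>(3)[of t2 l3] t2 by simp
      moreover have "dist (\<sigma> s2) (\<tau> t2) = j2" using j2(1) \<omega>2(1)[of s2] \<omega>s2 by simp
      moreover have "dist p q \<le> dist p (\<sigma> s2) + dist (\<sigma> s2) (\<tau> t2) + dist (\<tau> t2) q"
        by (smt (verit) dist_triangle)
      ultimately show False using j2r \<eta>r rB B0 pq l1 l3 by argo
    qed
  qed
  then show "\<exists>N. \<forall>x x' p q. N \<le> infdist x Y \<longrightarrow> dist x x' \<le> (1 - c) * infdist x Y \<longrightarrow>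
      p \<in> near_proj 1 Y x \<longrightarrow> q \<in> near_proj 1 Y x' \<longrightarrow> dist p q \<le> c * infdist x Y"
    by blast
qed

subsection \<open>Rectifiable connections inside a set\<close>

text \<open>The length is bounded by the duration of a 1-Lipschitz parametrisation, which simply
  adds up under concatenation; \<open>joined_within_path\<close> translates to
  \<open>path_length\<close>.\<close>

definition joined_within :: "'a::metric_space set \<Rightarrow> real \<Rightarrow> 'a \<Rightarrow> 'a \<Rightarrow> bool" where
  "joined_within S len x y \<longleftrightarrow>
     (\<exists>T f. 0 \<le> T \<and> T \<le> len \<and> 1-lipschitz_on {0..T} f \<and> f 0 = x \<and> f T = y \<and> f ` {0..T} \<subseteq> S)"

lemma joined_within_mono: "joined_within S len x y \<Longrightarrow> len \<le> len' \<Longrightarrow> joined_within S len' x y"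
  unfolding joined_within_def by (elim exE conjE, intro exI conjI) (assumption | simp)+

lemma joined_within_refl: "x \<in> S \<Longrightarrow> joined_within S 0 x x"
  unfolding joined_within_def
  by (intro exI[of _ 0] exI[of _ "\<lambda>_. x"]) (auto intro!: lipschitz_onI)

lemma joined_within_sym:
  assumes "joined_within S len x y"
  shows "joined_within S len y x"
proof -
  from assms obtain T f where f: "0 \<le> T" "T \<le> len" "1-lipschitz_on {0..T} f" "f 0 = x" "f T = y"
    "f ` {0..T} \<subseteq> S" unfolding joined_within_def by blast
  have "1-lipschitz_on {0..T} (\<lambda>t. f (T - t))"
  proof (rule lipschitz_onI)
    fix u v assume "u \<in> {0..T}" "v \<in> {0..T}"
    then show "dist (f (T - u)) (f (T - v)) \<le> 1 * dist u v"
      using lipschitz_onD[OF f(3), of "T - u" "T - v"] by (simp add: dist_real_def abs_minus_commute)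
  qed simp
  moreover have "(\<lambda>t. f (T - t)) ` {0..T} \<subseteq> S" using f(6) by (auto simp: image_subset_iff)
  ultimately show ?thesis unfolding joined_within_def
    using f by (intro exI[of _ T] exI[of _ "\<lambda>t. f (T - t)"]) auto
qed

lemma joined_within_trans:
  assumes "joined_within S a x y" "joined_within S b y z"
  shows "joined_within S (a + b) x z"
proof -
  from assms(1) obtain T f where f: "0 \<le> T" "T \<le> a" "1-lipschitz_on {0..T} f" "f 0 = x" "f T = y"
    "f ` {0..T} \<subseteq> S" unfolding joined_within_def by blast
  from assms(2) obtain U g where g: "0 \<le> U" "U \<le> b" "1-lipschitz_on {0..U} g" "g 0 = y" "g U = z"
    "g ` {0..U} \<subseteq> S" unfolding joined_within_def by blast
  define h where "h = (\<lambda>t. if t \<le> T then f t else g (t - T))"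
  have "1-lipschitz_on {T..T + U} (\<lambda>t. g (t - T))"
  proof (rule lipschitz_onI)
    fix u v assume "u \<in> {T..T + U}" "v \<in> {T..T + U}"
    then show "dist (g (u - T)) (g (v - T)) \<le> 1 * dist u v"
      using lipschitz_onD[OF g(3), of "u - T" "v - T"] by (auto simp: dist_real_def)
  qed simp
  then have "1-lipschitz_on {0..T + U} h"
    unfolding h_def using f g by (intro lipschitz_on_concat) auto
  moreover have "h ` {0..T + U} \<subseteq> S" using f(6) g(6) by (auto simp: h_def image_subset_iff)
  moreover have "h (T + U) = z" using f g by (cases "U = 0") (auto simp: h_def)
  ultimately show ?thesis unfolding joined_within_def
    using f g by (intro exI[of _ "T + U"] exI[of _ h]) (auto simp: h_def)
qed

text \<open>Points of a geodesic give equality in the triangle inequality, so membership in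
  \<open>S\<close> can be checked without naming the geodesic.\<close>

lemma joined_within_geodesic:
  fixes x y :: "'a::geodesic_metric_space"
  assumes "\<And>z. dist x z + dist z y = dist x y \<Longrightarrow> z \<in> S"
  shows "joined_within S (dist x y) x y"
proof -
  obtain g where g: "g 0 = x" "g (dist x y) = y"
    "\<And>s t. \<lbrakk>0 \<le> s; s \<le> dist x y; 0 \<le> t; t \<le> dist x y\<rbrakk> \<Longrightarrow> dist (g s) (g t) = \<bar>s - t\<bar>"
    by (rule geodesic_obtain) blast
  have "1-lipschitz_on {0..dist x y} g"
    using g(3) by (intro lipschitz_onI) (auto simp: dist_real_def)
  moreover have "g t \<in> S" if "t \<in> {0..dist x y}" for t
    using g(3)[of 0 t] g(3)[of t "dist x y"] g(1,2) that by (intro assms) auto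
  ultimately show ?thesis unfolding joined_within_def
    using g by (intro exI[of _ "dist x y"] exI[of _ g]) auto
qed

lemma path_length_lipschitz:
  assumes "T-lipschitz_on {0..1} p"
  shows "path_length p \<le> ereal T"
  unfolding path_length_def
proof (rule SUP_least)
  fix ts :: "real list" assume "ts \<in> {ts. sorted ts \<and> set ts \<subseteq> {0..1}}"
  then have ts: "sorted ts" "set ts \<subseteq> {0..1}" by auto
  have T: "0 \<le> T" by (rule lipschitz_on_nonneg[OF assms])
  let ?n = "length ts - 1"
  have "(\<Sum>i<?n. dist (p (ts ! i)) (p (ts ! Suc i))) \<le> (\<Sum>i<?n. T * (ts ! Suc i - ts ! i))"
  proof (rule sum_mono)
    fix i assume "i \<in> {..<?n}"
    then have i: "i < length ts" "Suc i < length ts" by auto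
    then have "ts ! i \<in> {0..1}" "ts ! Suc i \<in> {0..1}" using ts(2) nth_mem by blast+
    moreover have "ts ! i \<le> ts ! Suc i" using sorted_nth_mono[OF ts(1), of i "Suc i"] i by simp
    ultimately show "dist (p (ts ! i)) (p (ts ! Suc i)) \<le> T * (ts ! Suc i - ts ! i)"
      using lipschitz_onD[OF assms, of "ts ! i" "ts ! Suc i"] by (simp add: dist_real_def)
  qed
  also have "\<dots> = T * (ts ! ?n - ts ! 0)"
    by (simp add: sum_distrib_left[symmetric] sum_lessThan_telescope)
  also have "\<dots> \<le> T"
  \<comment> \<open>For the empty list \<open>?n\<close> is 0 by truncated subtraction, and the
    difference is 0 whatever \<open>ts ! 0\<close> is.\<close>
  proof (cases "ts = []")
    case True
    then show ?thesis using T by simp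
  next
    case False
    then have "ts ! ?n \<in> set ts" "ts ! 0 \<in> set ts" by auto
    then have "ts ! ?n \<in> {0..1}" "ts ! 0 \<in> {0..1}" using ts(2) by blast+
    then show ?thesis using T by (intro mult_left_le) auto
  qed
  finally show "ereal (\<Sum>i<?n. dist (p (ts ! i)) (p (ts ! Suc i))) \<le> ereal T" by simp
qed

lemma joined_within_path:
  assumes "joined_within S len x y"
  obtains p where "path p" "pathstart p = x" "pathfinish p = y" "path_image p \<subseteq> S"
    "path_length p \<le> ereal len"
proof -
  from assms obtain T f where f: "0 \<le> T" "T \<le> len" "1-lipschitz_on {0..T} f" "f 0 = x" "f T = y"
    "f ` {0..T} \<subseteq> S" unfolding joined_within_def by blast
  define p where "p t = f (T * t)" for t
  have in_T: "T * t \<in> {0..T}" if "t \<in> {0..1}" for t using f(1) that by (auto intro: mult_left_le)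
  have p: "T-lipschitz_on {0..1} p"
  proof (rule lipschitz_onI[OF _ f(1)])
    fix u v :: real assume "u \<in> {0..1}" "v \<in> {0..1}"
    then have "dist (p u) (p v) \<le> 1 * dist (T * u) (T * v)"
      unfolding p_def by (intro lipschitz_onD[OF f(3)] in_T)
    also have "\<dots> = T * dist u v"
      using f(1) by (simp add: dist_real_def abs_mult flip: right_diff_distrib)
    finally show "dist (p u) (p v) \<le> T * dist u v" .
  qed
  show thesis
  proof (rule that)
    show "path p" unfolding path_def by (rule lipschitz_on_continuous_on[OF p])
    show "pathstart p = x" "pathfinish p = y" using f by (auto simp: p_def pathstart_def pathfinish_def)
    show "path_image p \<subseteq> S" using f(6) in_T by (auto simp: p_def path_image_def image_subset_iff)
    have "path_length p \<le> ereal T" by (rule path_length_lipschitz[OF p])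
    also have "\<dots> \<le> ereal len" using f by simp
    finally show "path_length p \<le> ereal len" .
  qed
qed

text \<open>As \<gamma> may be discontinuous, its points at successive unit times are joined by
  geodesics, each of length at most \<open>L + A\<close> and hence inside a ball around a point of
  \<gamma>. The summand 1 pays for rounding up the number of steps.\<close>

lemma joined_within_quasi_geodesic:
  fixes \<gamma> :: "real \<Rightarrow> 'a::geodesic_metric_space"
  assumes qg: "quasi_geodesic_on L A UNIV \<gamma>" and "u \<le> v"
    and near: "\<And>w. \<lbrakk>u \<le> w; w \<le> v\<rbrakk> \<Longrightarrow> cball (\<gamma> w) (L + A) \<subseteq> S"
  shows "joined_within S ((L + A) * (v - u + 1)) (\<gamma> u) (\<gamma> v)"
proof -
  have LA: "0 \<le> L" "0 \<le> A" using qg by (auto simp: quasi_geodesic_on_def)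
  have "joined_within S ((L + A) * real n) (\<gamma> w) (\<gamma> v)" if "u \<le> w" "w \<le> v" "v - w \<le> real n" for n w
    using that
  proof (induction n arbitrary: w)
    case 0
    then have "w = v" by simp
    then show ?case using near[OF 0(1,2)] LA by (auto intro!: joined_within_refl)
  next
    case (Suc n)
    define w' where "w' = min (w + 1) v"
    have w': "u \<le> w'" "w' \<le> v" "v - w' \<le> real n" "\<bar>w - w'\<bar> \<le> 1" using Suc.prems by (auto simp: w'_def)
    have "dist (\<gamma> w) (\<gamma> w') \<le> L * \<bar>w - w'\<bar> + A" using qg by (auto simp: quasi_geodesic_on_def)
    also have "\<dots> \<le> L * 1 + A" using w'(4) LA by (intro add_right_mono mult_left_mono)
    finally have d: "dist (\<gamma> w) (\<gamma> w') \<le> L + A" by simp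
    have "joined_within S (dist (\<gamma> w) (\<gamma> w')) (\<gamma> w) (\<gamma> w')"
    proof (rule joined_within_geodesic)
      fix z assume "dist (\<gamma> w) z + dist z (\<gamma> w') = dist (\<gamma> w) (\<gamma> w')"
      then have "dist (\<gamma> w) z \<le> L + A" using d zero_le_dist[of z "\<gamma> w'"] by linarith
      then show "z \<in> S" using near[OF Suc.prems(1,2)] by auto
    qed
    then have "joined_within S (L + A) (\<gamma> w) (\<gamma> w')" using d by (rule joined_within_mono)
    from joined_within_trans[OF this Suc.IH[OF w'(1-3)]] show ?case by (simp add: algebra_simps)
  qed
  from this[of u "nat \<lceil>v - u\<rceil>"]
  have "joined_within S ((L + A) * real (nat \<lceil>v - u\<rceil>)) (\<gamma> u) (\<gamma> v)"
    using \<open>u \<le> v\<close> by (simp add: real_nat_ceiling_ge)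
  moreover have "real (nat \<lceil>v - u\<rceil>) \<le> v - u + 1" using \<open>u \<le> v\<close> by linarith
  then have "(L + A) * real (nat \<lceil>v - u\<rceil>) \<le> (L + A) * (v - u + 1)" using LA by (intro mult_left_mono) auto
  ultimately show ?thesis by (rule joined_within_mono)
qed

subsection \<open>Superlinear divergence implies sublinear contraction\<close>

text \<open>A geodesic from \<open>x\<close> to a nearly closest point \<open>p\<close> of \<open>Y\<close> moves away from \<open>Y\<close> almost at unit speed,
  so it stays away from the points of \<open>Y\<close> that are far from \<open>p\<close>.\<close>

lemma dist_on_projection_geodesic_ge:
  assumes p: "p \<in> near_proj \<epsilon> Y x" and z: "dist x z + dist z p = dist x p" and "y \<in> Y"
  shows "dist p y - \<epsilon> \<le> 2 * dist y z"
proof -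
  have "infdist x Y \<le> dist y z + dist x z"
    using infdist_triangle[of x Y z] infdist_le[OF \<open>y \<in> Y\<close>, of z] by (simp add: dist_commute)
  then have "dist z p - \<epsilon> \<le> dist y z" using near_projD(2)[OF p] z by simp
  then show ?thesis using dist_triangle[of p y z] by (simp add: dist_commute)
qed

text \<open>A failure of contraction at height \<open>r\<close> yields a detour \<open>p\<close>,
  \<open>x\<close>, \<open>y\<close>, \<open>q\<close> of length at most \<open>4 * r + 2\<close>.
  It is prolonged along \<gamma> from the parameters \<open>m - h\<close> and \<open>m + h\<close>
  of its ends inwards to \<open>m - r'\<close> and \<open>m + r'\<close>. The result avoids the ball
  around \<gamma>\<open>(m)\<close>, and its length is linear in \<open>r'\<close>, so superlinear
  divergence bounds \<open>r'\<close>.\<close>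

lemma completely_superlinear_imp_sublinearly_contracting:
  fixes \<gamma> :: "real \<Rightarrow> 'a::geodesic_metric_space"
  assumes qg: "quasi_geodesic_on L A UNIV \<gamma>" and l: "0 < l" "l \<le> 1" and \<kappa>: "L + A \<le> \<kappa>"
    and div: "completely_superlinear (divergence \<gamma> L A l \<kappa>)"
  shows "sublinearly_contracting (range \<gamma>)"
proof (rule sublinearly_contractingI_smaller_balls)
  let ?Y = "range \<gamma>"
  have L: "1 \<le> L" and A: "0 \<le> A" using qg by (auto simp: quasi_geodesic_on_def)
  have lo: "\<bar>u - v\<bar> / L - A \<le> dist (\<gamma> u) (\<gamma> v)" and up: "dist (\<gamma> u) (\<gamma> v) \<le> L * \<bar>u - v\<bar> + A" for u v
    using qg unfolding quasi_geodesic_on_def by blast+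
  fix c :: real assume c: "0 < c" "c \<le> 1 / 2"
  \<comment> \<open>The first factor is the coefficient of \<open>r\<close> in the length of the
    path; the second is the ratio of \<open>r\<close> to \<open>r'\<close>.\<close>
  define C where "C = (4 + L * (L + A) * 4) * (8 * L / c)"
  define C4 where "C4 = 2 + (L + A) * (L * (2 + A) + 2)"
  have C: "0 < C" "0 \<le> C4" using L A c unfolding C_def C4_def
    by (auto intro!: mult_pos_pos divide_pos_pos add_pos_nonneg add_nonneg_nonneg mult_nonneg_nonneg)
  have "bounded {r. 0 \<le> r \<and> divergence \<gamma> L A l \<kappa> r \<le> ereal (C * r + C4)}"
    using div[unfolded completely_superlinear_def, rule_format, of C 1 0 C4] C by simp
  then obtain B where B: "\<And>r. \<lbrakk>0 \<le> r; divergence \<gamma> L A l \<kappa> r \<le> ereal (C * r + C4)\<rbrakk> \<Longrightarrow> r \<le> B"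
    unfolding bounded_iff by fastforce
  \<comment> \<open>The two entries make \<open>r'\<close> at least \<open>\<bar>B\<bar> + 1\<close>
    and \<open>L * (A + 1)\<close>.\<close>
  define N where "N = max (8 * L * (\<bar>B\<bar> + 1) / c) (8 * L * L * (A + 1) / c)"
  have "dist p q \<le> c * infdist x ?Y"
    if r: "N \<le> infdist x ?Y" and xy: "dist x y \<le> (1 - c) * infdist x ?Y"
      and p: "p \<in> near_proj 1 ?Y x" and q: "q \<in> near_proj 1 ?Y y" for x y p q
  proof (rule ccontr)
    assume neg: "\<not> dist p q \<le> c * infdist x ?Y"
    define r where "r = infdist x ?Y"
    define r' where "r' = c * r / (8 * L)"
    have pq: "c * r < dist p q" using neg by (simp add: r_def)
    have r'B: "\<bar>B\<bar> + 1 \<le> r'" and r'A: "L * (A + 1) \<le> r'"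
      using r c L by (auto simp: N_def r_def r'_def field_simps)
    have r'0: "0 \<le> r'" using r'B by simp
    have cr: "c * r = 8 * (L * r')" using L by (simp add: r'_def)
    have Lr': "r' / L \<le> r'" "r' \<le> L * r'" "A + 1 \<le> r' / L"
      using L r'0 r'A mult_right_mono[OF L r'0] by (auto simp: field_simps)
    have r0: "0 \<le> r" by (simp add: r_def infdist_nonneg)
    have "0 \<le> c * r" using c r0 by simp
    then have xy_r: "dist x y \<le> r - c * r" "dist x y \<le> r" using xy by (auto simp: r_def algebra_simps)
    have px: "dist x p \<le> r + 1" using near_projD(2)[OF p] by (simp add: r_def)
    have "infdist y ?Y \<le> 2 * r" using infdist_triangle[of y ?Y x] xy_r by (simp add: r_def dist_commute)
    then have yq: "dist y q \<le> 2 * r + 1" using near_projD(2)[OF q] by simp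
    obtain a b where ab: "p = \<gamma> a" "q = \<gamma> b" using near_projD(1)[OF p] near_projD(1)[OF q] by blast
    define m where "m = (a + b) / 2"
    define h where "h = \<bar>a - b\<bar> / 2"
    have h: "\<bar>a - m\<bar> = h" "\<bar>b - m\<bar> = h" by (auto simp: m_def h_def field_simps abs_if)
    have "dist p q \<le> 2 * (L * h) + A" using up[of a b] by (simp add: ab h_def)
    then have "2 * (4 * (L * r')) \<le> 2 * (L * h) + L * r'" using pq cr Lr' L A r'A by linarith
    then have "L * (2 * r') \<le> L * h" using mult_nonneg_nonneg[of L r'] L r'0 by linarith
    then have hr': "2 * r' \<le> h" using L by simp
    have "dist p q \<le> 4 * r + 2"
      using dist_near_proj_le[OF p q] xy_r by (simp add: r_def)
    then have "2 * h / L - A \<le> 4 * r + 2" using lo[of a b] by (simp add: ab h_def)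
    then have hr: "2 * h \<le> L * (4 * r + 2 + A)" using L by (simp add: field_simps)
    \<comment> \<open>The complement of the open ball to be avoided when \<open>l = 1\<close>;
      smaller \<open>l\<close> shrinks that ball.\<close>
    define S where "S = {z. r' / L - A - \<kappa> \<le> dist (\<gamma> m) z}"
    have "2 * r' / L \<le> h / L" using hr' L by (intro divide_right_mono) auto
    then have far: "2 * (r' / L) - A \<le> dist p (\<gamma> m)" "2 * (r' / L) - A \<le> dist q (\<gamma> m)"
      using lo[of a m] lo[of b m] by (auto simp: ab h)
    have "joined_within S (dist x p) x p"
    proof (rule joined_within_geodesic)
      fix z assume "dist x z + dist z p = dist x p"
      from dist_on_projection_geodesic_ge[OF p this, of "\<gamma> m"] show "z \<in> S"
        using far(1) L A \<kappa> by (simp add: S_def)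
    qed
    then have 1: "joined_within S (r + 1) p x" using joined_within_sym joined_within_mono px by blast
    have "joined_within S (dist x y) x y"
    proof (rule joined_within_geodesic)
      fix z assume "dist x z + dist z y = dist x y"
      \<comment> \<open>The geodesic stays within \<open>(1 - c) * r\<close> of \<open>x\<close>,
        while \<gamma>\<open>(m)\<close> is at distance at least \<open>r\<close> from
        \<open>x\<close>.\<close>
      then have "dist x z \<le> r - c * r" using xy_r zero_le_dist[of z y] by linarith
      moreover have "r \<le> dist (\<gamma> m) z + dist x z"
        using infdist_triangle[of x ?Y z] infdist_le[of "\<gamma> m" ?Y z] by (simp add: r_def dist_commute)
      ultimately have "r' / L - A - \<kappa> \<le> dist (\<gamma> m) z" using Lr' cr r'0 A \<kappa> L by argo
      then show "z \<in> S" by (simp add: S_def)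
    qed
    then have 2: "joined_within S r x y" using xy_r(2) by (rule joined_within_mono)
    have "joined_within S (dist y q) y q"
    proof (rule joined_within_geodesic)
      fix z assume "dist y z + dist z q = dist y q"
      from dist_on_projection_geodesic_ge[OF q this, of "\<gamma> m"] show "z \<in> S"
        using far(2) L A \<kappa> by (simp add: S_def)
    qed
    then have 3: "joined_within S (2 * r + 1) y q" using yq by (rule joined_within_mono)
    have pq_joined: "joined_within S (4 * r + 2) (\<gamma> a) (\<gamma> b)"
      using joined_within_mono[OF joined_within_trans[OF joined_within_trans[OF 1 2] 3]] by (simp add: ab)
    have mid: "joined_within S (4 * r + 2) (\<gamma> (m - h)) (\<gamma> (m + h))"
    proof (cases "a \<le> b")
      case True
      then have "m - h = a" "m + h = b" by (auto simp: m_def h_def field_simps)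
      then show ?thesis using pq_joined by simp
    next
      case False
      then have "m - h = b" "m + h = a" by (auto simp: m_def h_def field_simps)
      then show ?thesis using joined_within_sym[OF pq_joined] by simp
    qed
    \<comment> \<open>The joining geodesics may stray by \<open>L + A\<close> from \<gamma>, which
      \<open>\<kappa>\<close> compensates.\<close>
    have near: "cball (\<gamma> w) (L + A) \<subseteq> S" if "r' \<le> \<bar>w - m\<bar>" for w
    proof
      fix z assume "z \<in> cball (\<gamma> w) (L + A)"
      then have z: "dist (\<gamma> w) z \<le> L + A" by simp
      have "r' / L \<le> \<bar>w - m\<bar> / L" using that L by (intro divide_right_mono) auto
      then have "r' / L - A \<le> dist (\<gamma> w) (\<gamma> m)" using lo[of w m] by linarith
      then show "z \<in> S"
        using z \<kappa> dist_triangle[of "\<gamma> w" "\<gamma> m" z] by (simp add: S_def dist_commute)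
    qed
    let ?side = "(L + A) * (h - r' + 1)"
    have "joined_within S ((L + A) * ((m - r') - (m - h) + 1)) (\<gamma> (m - h)) (\<gamma> (m - r'))"
      by (rule joined_within_quasi_geodesic[OF qg]) (use near hr' r'0 in auto)
    then have left: "joined_within S ?side (\<gamma> (m - r')) (\<gamma> (m - h))"
      by (rule joined_within_sym[OF joined_within_mono]) simp
    have "joined_within S ((L + A) * ((m + h) - (m + r') + 1)) (\<gamma> (m + r')) (\<gamma> (m + h))"
      by (rule joined_within_quasi_geodesic[OF qg]) (use near hr' r'0 in auto)
    then have right: "joined_within S ?side (\<gamma> (m + h)) (\<gamma> (m + r'))"
      by (rule joined_within_sym[OF joined_within_mono]) simp
    have joined: "joined_within S (?side + (4 * r + 2) + ?side) (\<gamma> (m - r')) (\<gamma> (m + r'))"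
      by (rule joined_within_trans[OF joined_within_trans[OF left mid] right])
    have "?side \<le> (L + A) * (h + 1)" using L A r'0 by (intro mult_left_mono) auto
    then have "2 * ?side \<le> (L + A) * (2 * h + 2)" by (simp add: algebra_simps)
    also have "\<dots> \<le> (L + A) * (L * (4 * r + 2 + A) + 2)" using hr L A by (intro mult_left_mono) auto
    finally have "2 * ?side + (4 * r + 2) \<le> (L + A) * (L * (4 * r + 2 + A) + 2) + (4 * r + 2)"
      by (rule add_right_mono)
    also have "\<dots> = (4 + L * (L + A) * 4) * r + C4" unfolding C4_def by algebra
    finally have "?side + (4 * r + 2) + ?side \<le> (4 + L * (L + A) * 4) * r + C4"
      unfolding mult_2 by (simp only: add_ac)
    also have "(4 + L * (L + A) * 4) * r = C * r'" using L c by (simp add: C_def r'_def)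
    finally have len: "?side + (4 * r + 2) + ?side \<le> C * r' + C4" .
    from joined_within_path[OF joined_within_mono[OF joined len]] obtain g where
      g: "path g" "pathstart g = \<gamma> (m - r')" "pathfinish g = \<gamma> (m + r')" "path_image g \<subseteq> S"
        "path_length g \<le> ereal (C * r' + C4)" .
    have "l * (r' / L - A) \<le> 1 * (r' / L - A)" using l Lr' by (intro mult_right_mono) auto
    then have "path_image g \<inter> ball (\<gamma> m) (l * (r' / L - A) - \<kappa>) = {}"
      using g(4) by (force simp: S_def)
    then have "avoiding_length \<gamma> L A l \<kappa> r' m \<le> path_length g"
      unfolding avoiding_length_def using g by (intro INF_lower) auto
    moreover have "divergence \<gamma> L A l \<kappa> r' \<le> avoiding_length \<gamma> L A l \<kappa> r' m"
      unfolding divergence_def by (rule INF_lower) simp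
    ultimately have "divergence \<gamma> L A l \<kappa> r' \<le> ereal (C * r' + C4)" using g(5) by (meson order.trans)
    then have "r' \<le> B" using B r'0 by blast
    with r'B show False by simp
  qed
  then show "\<exists>N. \<forall>x x' p q. N \<le> infdist x ?Y \<longrightarrow> dist x x' \<le> (1 - c) * infdist x ?Y \<longrightarrow>
      p \<in> near_proj 1 ?Y x \<longrightarrow> q \<in> near_proj 1 ?Y x' \<longrightarrow> dist p q \<le> c * infdist x ?Y"
    by blast
qed simp

theorem theorem1p3:
  fixes \<gamma> :: "real \<Rightarrow> 'a::geodesic_metric_space"
    and L A l \<kappa> :: real
  assumes "quasi_geodesic_on L A UNIV \<gamma>"
    and "0 < l" "l \<le> 1"
    and "\<kappa> \<ge> L + A"
  shows "(sublinearly_contracting (range \<gamma>) \<longleftrightarrow> Morse (range \<gamma>)) \<and>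
         (Morse (range \<gamma>) \<longleftrightarrow> completely_superlinear (divergence \<gamma> L A l \<kappa>))"
proof -
  have "Morse (range \<gamma>)" if "sublinearly_contracting (range \<gamma>)"
    by (rule sublinearly_contracting_imp_Morse[OF that])
  moreover have "sublinearly_contracting (range \<gamma>)" if "Morse (range \<gamma>)"
    by (rule Morse_imp_sublinearly_contracting[OF _ that]) simp
  moreover have "completely_superlinear (divergence \<gamma> L A l \<kappa>)" if "sublinearly_contracting (range \<gamma>)"
    by (rule sublinearly_contracting_imp_completely_superlinear[OF assms(1,2) that])
  moreover have "sublinearly_contracting (range \<gamma>)" if "completely_superlinear (divergence \<gamma> L A l \<kappa>)"
    by (rule completely_superlinear_imp_sublinearly_contracting[OF assms that])
  ultimately show ?thesis by blast
qed

end
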